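(* Let $K$ be a finite simplicial complex and let $\tau$ be a simplex (possibly empty) whose vertex set is disjoint from $V_K$. Then $K$ is a minimal $NH$-sphere if and only if $K^{\tau}$ is a minimal $NH$-sphere.
   Context: All simplicial complexes are finite. $\Delta^d$ denotes a $d$-simplex, $\partial\Delta^d$ its boundary; $\{\emptyset\}$ is the complex with only the empty simplex, regarded as the sphere of dimension $-1$. $V_K$ is the vertex set of $K$; $\Delta(V)$ is the simplex spanned by $V$. A simplex is principal in $K$ if it is not a proper face of another simplex; $\mathsf{m}(K)$ is the number of principal simplices. A subcomplex $L\subset K$ is top generated if every principal simplex of $L$ is principal in $K$. $K+L$ denotes union; $lk(v,K)$ is the link. A combinatorial $d$-ball is a complex having a common subdivision with $\Delta^d$; its boundary $\partial L$ is generated by the $(d-1)$-simplices that are faces of exactly one $d$-simplex. A complex is collapsible if some subdivision collapses simplicially to a vertex. $NH$-manifolds/balls/spheres of dimension $0$ are the $0$-dimensional manifolds/balls/spheres; the $NH$-sphere of dimension $-1$ is $\{\emptyset\}$. For $d\ge1$ inductively: an $NH$-manifold of dimension $d$ is a $d$-dimensional complex $M$ such that each vertex link is an $NH$-ball of dimension in $[0,d-1]$ or an $NH$-sphere of dimension in $[-1,d-1]$; an $NH$-ball of dimension $d$ is a collapsible $NH$-manifold of dimension $d$; an $NH$-sphere of dimension $d$ and homotopy dimension $k$ is an $NH$-manifold $S$ of dimension $d$ for which there exist a top generated $NH$-ball $B$ of dimension $d$ and a top generated combinatorial $k$-ball $L$ with $B+L=S$, $B\cap L=\partial L$; write $\dim_h(S)=k$.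 A minimal $NH$-sphere is an $NH$-sphere $S$ with $\mathsf{m}(S)=\dim_h(S)+2$. Alexander dual: for $V\supseteq V_K$, $K^{*_V}=\{\sigma\in\Delta(V):\Delta(V-V_\sigma)\notin K\}$. For a simplex $\tau$ with vertices disjoint from $V_K$, $K^\tau:=K^{*_V}$ with $V=V_K\cup V_\tau$; in particular $K^{\emptyset}=K^*:=K^{*_{V_K}}$.
   Formalization: The single pair K = {∅}, τ = ∅ is excluded: there {∅} is a minimal NH-sphere (m = 1 = −1+2), but K^τ is the void family with no simplices, so the equivalence fails. *)

theory Defs
  imports Complex_Main
begin

text \<open>
  A finite simplicial complex is represented by the set of its simplices, each simplex being the
  finite set of its vertices. The empty simplex belongs to every complex, so the smallest complex
  is \<open>{{}}\<close>; the void family \<open>{}\<close> is not a complex.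
\<close>

definition abstract_complex :: "'a set set \<Rightarrow> bool" where
  "abstract_complex K \<longleftrightarrow>
     finite K \<and> {} \<in> K \<and> (\<forall>\<sigma>\<in>K. finite \<sigma> \<and> (\<forall>\<rho>. \<rho> \<subseteq> \<sigma> \<longrightarrow> \<rho> \<in> K))"

definition vertices :: "'a set set \<Rightarrow> 'a set" where
  "vertices K = \<Union>K"

definition simplex_dim :: "'a set \<Rightarrow> int" where
  "simplex_dim \<sigma> = int (card \<sigma>) - 1"

definition complex_dim :: "'a set set \<Rightarrow> int" where
  "complex_dim K = Max (simplex_dim ` K)"

definition principal_simplices :: "'a set set \<Rightarrow> 'a set set" where
  "principal_simplices K = {\<sigma> \<in> K. \<not> (\<exists>\<rho>\<in>K. \<sigma> \<subset> \<rho>)}"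

definition num_principal :: "'a set set \<Rightarrow> nat" where
  "num_principal K = card (principal_simplices K)"

definition top_generated :: "'a set set \<Rightarrow> 'a set set \<Rightarrow> bool" where
  "top_generated L K \<longleftrightarrow>
     abstract_complex L \<and> L \<subseteq> K \<and> principal_simplices L \<subseteq> principal_simplices K"

definition vertex_link :: "'a \<Rightarrow> 'a set set \<Rightarrow> 'a set set" where
  "vertex_link v K = {\<sigma> \<in> K. v \<notin> \<sigma> \<and> insert v \<sigma> \<in> K}"

definition complex_boundary :: "'a set set \<Rightarrow> 'a set set" where
  "complex_boundary L =
     {\<sigma>. \<exists>\<rho>\<in>L. \<sigma> \<subseteq> \<rho> \<and> simplex_dim \<rho> = complex_dim L - 1 \<and>
           (\<exists>!\<eta>. \<eta> \<in> L \<and> simplex_dim \<eta> = complex_dim L \<and> \<rho> \<subseteq> \<eta>)}"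

text \<open>The polyhedron of \<open>K\<close>, in barycentric coordinates.\<close>

definition realization :: "'a set set \<Rightarrow> ('a \<Rightarrow> real) set" where
  "realization K =
     {x. (\<forall>a. 0 \<le> x a) \<and> {a. x a \<noteq> 0} \<in> K \<and> (\<Sum>a\<in>vertices K. x a) = 1}"

definition linear_extension ::
    "'b set set \<Rightarrow> ('b \<Rightarrow> 'a \<Rightarrow> real) \<Rightarrow> ('b \<Rightarrow> real) \<Rightarrow> 'a \<Rightarrow> real" where
  "linear_extension M \<phi> x = (\<lambda>a. \<Sum>v\<in>vertices M. x v * \<phi> v a)"

text \<open>
  \<open>M\<close> is, up to relabelling of its vertices, a linear subdivision of \<open>K\<close>: placing each vertex \<open>v\<close> of
  \<open>M\<close> at the point \<open>\<phi> v\<close> of the polyhedron of \<open>K\<close>, every simplex of \<open>M\<close> spans a geometric simplex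
  lying in a simplex of \<open>K\<close>, and these form a geometric complex with the same polyhedron as \<open>K\<close>.
  Nondegeneracy of the simplices, the requirement that they meet in common faces, and equality of
  the polyhedra are together the bijectivity of the linear extension of \<open>\<phi>\<close>.
\<close>

definition is_subdivision :: "'b set set \<Rightarrow> 'a set set \<Rightarrow> bool" where
  "is_subdivision M K \<longleftrightarrow> abstract_complex M \<and> abstract_complex K \<and>
     (\<exists>\<phi>. (\<forall>\<sigma>\<in>M. \<exists>\<rho>\<in>K. \<forall>v\<in>\<sigma>. {a. \<phi> v a \<noteq> 0} \<subseteq> \<rho>) \<and>
          bij_betw (linear_extension M \<phi>) (realization M) (realization K))"

text \<open>
  Since complexes are finite and subdivisions are taken up to relabelling, it is no restriction
  to let subdivisions have natural numbers as vertices.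
\<close>

definition common_subdivision :: "'a set set \<Rightarrow> 'b set set \<Rightarrow> bool" where
  "common_subdivision K L \<longleftrightarrow>
     (\<exists>M :: nat set set. is_subdivision M K \<and> is_subdivision M L)"

definition std_simplex :: "int \<Rightarrow> int set set" where
  "std_simplex d = Pow {0..d}"

definition combinatorial_ball :: "int \<Rightarrow> 'a set set \<Rightarrow> bool" where
  "combinatorial_ball d L \<longleftrightarrow> 0 \<le> d \<and> common_subdivision L (std_simplex d)"

definition combinatorial_sphere :: "int \<Rightarrow> 'a set set \<Rightarrow> bool" where
  "combinatorial_sphere d S \<longleftrightarrow>
     0 \<le> d \<and> common_subdivision S (complex_boundary (std_simplex (d + 1)))"

text \<open>
  Removal of a nonempty free face \<open>\<sigma>\<close> together with the unique simplex \<open>\<eta>\<close> properly containing it;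
  uniqueness forces \<open>\<eta>\<close> to be principal and \<open>\<sigma>\<close> to have codimension one in it.
\<close>

definition elementary_collapse :: "'a set set \<Rightarrow> 'a set set \<Rightarrow> bool" where
  "elementary_collapse K L \<longleftrightarrow>
     (\<exists>\<sigma>\<in>K. \<exists>\<eta>\<in>K. \<sigma> \<noteq> {} \<and> \<sigma> \<subset> \<eta> \<and> (\<forall>\<rho>\<in>K. \<sigma> \<subset> \<rho> \<longrightarrow> \<rho> = \<eta>) \<and> L = K - {\<sigma>, \<eta>})"

definition collapses_to :: "'a set set \<Rightarrow> 'a set set \<Rightarrow> bool" where
  "collapses_to = elementary_collapse\<^sup>*\<^sup>*"

definition collapsible :: "'a set set \<Rightarrow> bool" where
  "collapsible K \<longleftrightarrow>
     (\<exists>M :: nat set set. \<exists>v. is_subdivision M K \<and> collapses_to M {{}, {v}})"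

text \<open>
  \<open>NH_sphere d k S\<close> says that \<open>S\<close> is an \<open>NH\<close>-sphere of dimension \<open>d\<close> and homotopy dimension \<open>k\<close>. The
  spheres of dimension \<open>-1\<close> and \<open>0\<close> have homotopy dimension \<open>-1\<close> and \<open>0\<close>, respectively. The
  \<open>0\<close>-dimensional manifolds are the nonempty finite sets of points, that is, all \<open>0\<close>-dimensional
  complexes.
\<close>

inductive NH_manifold :: "int \<Rightarrow> 'a set set \<Rightarrow> bool"
  and NH_ball :: "int \<Rightarrow> 'a set set \<Rightarrow> bool"
  and NH_sphere :: "int \<Rightarrow> int \<Rightarrow> 'a set set \<Rightarrow> bool"
where
  NH_manifold_zero:
    "abstract_complex M \<Longrightarrow> complex_dim M = 0 \<Longrightarrow> NH_manifold 0 M"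
| NH_ball_zero:
    "combinatorial_ball 0 B \<Longrightarrow> NH_ball 0 B"
| NH_sphere_minus_one:
    "NH_sphere (-1) (-1) {{}}"
| NH_sphere_zero:
    "combinatorial_sphere 0 S \<Longrightarrow> NH_sphere 0 0 S"
| NH_manifold_pos:
    "1 \<le> d \<Longrightarrow> abstract_complex M \<Longrightarrow> complex_dim M = d \<Longrightarrow>
     \<forall>v\<in>vertices M.
       (\<exists>j. 0 \<le> j \<and> j \<le> d - 1 \<and> NH_ball j (vertex_link v M)) \<or>
       (\<exists>j k. -1 \<le> j \<and> j \<le> d - 1 \<and> NH_sphere j k (vertex_link v M)) \<Longrightarrow>
     NH_manifold d M"
| NH_ball_pos:
    "1 \<le> d \<Longrightarrow> NH_manifold d B \<Longrightarrow> collapsible B \<Longrightarrow> NH_ball d B"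
| NH_sphere_pos:
    "1 \<le> d \<Longrightarrow> NH_manifold d S \<Longrightarrow>
     top_generated B S \<Longrightarrow> NH_ball d B \<Longrightarrow>
     top_generated L S \<Longrightarrow> combinatorial_ball k L \<Longrightarrow>
     B \<union> L = S \<Longrightarrow> B \<inter> L = complex_boundary L \<Longrightarrow>
     NH_sphere d k S"

definition minimal_NH_sphere :: "'a set set \<Rightarrow> bool" where
  "minimal_NH_sphere S \<longleftrightarrow> (\<exists>d k. NH_sphere d k S \<and> int (num_principal S) = k + 2)"

text \<open>
  The dual can be the void family, which is not a complex: this happens when \<open>K\<close> is the full simplex
  on \<open>V\<close>, in particular for \<open>K = {{}}\<close> and \<open>V = {}\<close>, where \<open>K\<close> is itself a minimal \<open>NH\<close>-sphere.
\<close>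

definition alexander_dual :: "'a set \<Rightarrow> 'a set set \<Rightarrow> 'a set set" where
  "alexander_dual V K = {\<sigma>. \<sigma> \<subseteq> V \<and> V - \<sigma> \<notin> K}"

definition relative_dual :: "'a set set \<Rightarrow> 'a set \<Rightarrow> 'a set set" where
  "relative_dual K \<tau> = alexander_dual (vertices K \<union> \<tau>) K"

end

theory Submission imports Defs begin

text \<open>
  Let \<open>S = B + L\<close> be an \<open>NH\<close>-sphere of homotopy dimension \<open>k\<close> and \<open>F\<close> a \<open>k\<close>-simplex of \<open>L\<close>. Since
  \<open>B \<inter> L = \<partial>L\<close>, each of the \<open>k + 1\<close> ridges \<open>F - {v}\<close> lies in a principal simplex other than \<open>F\<close>, and
  these are pairwise distinct. So if \<open>S\<close> has only \<open>k + 2\<close> principal simplices, they are \<open>F\<close> and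
  \<open>F - {v} \<union> W v\<close> for \<open>v \<in> F\<close>, with \<open>W v\<close> nonempty and disjoint from \<open>F\<close>. The sets \<open>W v\<close> form a
  chain: otherwise the link in \<open>B\<close> of the intersection of two principal simplices would be a
  disjoint union of two simplices of positive dimension, which is neither an \<open>NH\<close>-ball nor an
  \<open>NH\<close>-sphere. The only geometric inputs are that subdivisions preserve dimension and that
  collapsible complexes are connected. Conversely, every complex of this shape is a minimal
  \<open>NH\<close>-sphere, because its vertex links, and those of the cone obtained by omitting \<open>F\<close>, are again of
  one of the two shapes.

  Relative to an ambient vertex set \<open>V\<close>, the complexes of this shape are those obtained from \<open>{{}}\<close>
  on a single ambient vertex by repeatedly adding a new vertex \<open>x\<close> to \<open>V\<close> and either keeping \<open>K\<close> or
  replacing it by \<open>Pow V \<union> x * K\<close>. Alexander duality interchanges these two operations.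
\<close>

section \<open>Subdivisions\<close>

text \<open>Gaussian elimination, by induction on the set of equations: an unknown \<open>p\<close>
  with nonzero coefficient in equation \<open>r\<close> is eliminated from the other equations, and
  its value is recovered from \<open>r\<close> at the end.\<close>

lemma homogeneous_system_nontrivial:
  fixes A :: "'e \<Rightarrow> 'v \<Rightarrow> real"
  assumes "finite R" "finite S" "card R < card S"
  shows "\<exists>c. (\<exists>v\<in>S. c v \<noteq> 0) \<and> (\<forall>a\<in>R. (\<Sum>v\<in>S. c v * A a v) = 0)"
  using assms
proof (induction R arbitrary: S A rule: finite_induct)
  case empty
  then have "S \<noteq> {}" by auto
  then show ?case by (auto intro!: exI[of _ "\<lambda>_. 1"])
next
  case (insert r R)
  show ?case
  proof (cases "\<forall>v\<in>S. A r v = 0")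
    case True
    from insert.hyps insert.prems have "card R < card S" by simp
    from insert.IH[OF insert.prems(1) this, of A] True show ?thesis by auto
  next
    case False
    then obtain p where p: "p \<in> S" "A r p \<noteq> 0" by auto
    define A' where "A' = (\<lambda>a v. A a v - A r v * A a p / A r p)"
    have "card R < card (S - {p})" using insert p by simp
    from insert.IH[OF _ this, of A'] insert.prems obtain c where
      c: "\<exists>v\<in>S - {p}. c v \<noteq> 0" "\<forall>a\<in>R. (\<Sum>v\<in>S - {p}. c v * A' a v) = 0" by auto
    define c' where "c' = c(p := - (\<Sum>v\<in>S - {p}. c v * A r v) / A r p)"
    have split: "(\<Sum>v\<in>S. c' v * A a v) = c' p * A a p + (\<Sum>v\<in>S - {p}. c v * A a v)" for a
      using p insert.prems by (simp add: sum.remove[of S p] c'_def)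
    have "(\<Sum>v\<in>S. c' v * A a v) = 0" if "a \<in> insert r R" for a
    proof (cases "a = r")
      case True
      then show ?thesis unfolding split using p by (simp add: c'_def)
    next
      case False
      with that c have "0 = (\<Sum>v\<in>S - {p}. c v * A' a v)" by auto
      also have "\<dots> = (\<Sum>v\<in>S - {p}. c v * A a v) - (\<Sum>v\<in>S - {p}. c v * A r v) * A a p / A r p"
        by (simp add: A'_def algebra_simps sum_subtractf sum_distrib_left sum_divide_distrib)
      finally show ?thesis unfolding split by (simp add: c'_def)
    qed
    moreover have "\<exists>v\<in>S. c' v \<noteq> 0" using c(1) by (auto simp: c'_def)
    ultimately show ?thesis by blast
  qed
qed

lemma abstract_complex_subset: "abstract_complex K \<Longrightarrow> \<sigma> \<in> K \<Longrightarrow> \<rho> \<subseteq> \<sigma> \<Longrightarrow> \<rho> \<in> K"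
  by (auto simp: abstract_complex_def)

lemma abstract_complex_finite: "abstract_complex K \<Longrightarrow> \<sigma> \<in> K \<Longrightarrow> finite \<sigma>"
  by (auto simp: abstract_complex_def)

lemma finite_vertices: "abstract_complex K \<Longrightarrow> finite (vertices K)"
  by (auto simp: abstract_complex_def vertices_def)

lemma complex_dim_ge: "abstract_complex K \<Longrightarrow> \<sigma> \<in> K \<Longrightarrow> int (card \<sigma>) - 1 \<le> complex_dim K"
  unfolding complex_dim_def simplex_dim_def by (rule Max_ge) (auto simp: abstract_complex_def)

lemma complex_dim_attained:
  assumes "abstract_complex K"
  obtains \<sigma> where "\<sigma> \<in> K" "int (card \<sigma>) - 1 = complex_dim K"
proof -
  have "complex_dim K \<in> simplex_dim ` K"
    unfolding complex_dim_def by (rule Max_in) (use assms in \<open>auto simp: abstract_complex_def\<close>)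
  with that show thesis by (auto simp: simplex_dim_def)
qed

lemma complex_dim_mono:
  assumes "abstract_complex K" "abstract_complex L" "\<And>\<sigma>. \<sigma> \<in> K \<Longrightarrow> \<exists>\<rho>\<in>L. card \<sigma> \<le> card \<rho>"
  shows "complex_dim K \<le> complex_dim L"
proof -
  obtain \<sigma> where \<sigma>: "\<sigma> \<in> K" "int (card \<sigma>) - 1 = complex_dim K"
    using complex_dim_attained assms(1) by blast
  then obtain \<rho> where "\<rho> \<in> L" "card \<sigma> \<le> card \<rho>" using assms(3) by blast
  with \<sigma> complex_dim_ge[OF assms(2), of \<rho>] show ?thesis by linarith
qed

section \<open>Invariance of dimension under subdivision\<close>

lemma sum_realization_support:
  assumes "abstract_complex M" "\<sigma> \<in> M" "\<And>v. v \<notin> \<sigma> \<Longrightarrow> x v = (0::real)"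
  shows "(\<Sum>v\<in>vertices M. x v * g v) = (\<Sum>v\<in>\<sigma>. x v * g v)"
  by (rule sum.mono_neutral_right) (use assms finite_vertices in \<open>auto simp: vertices_def\<close>)

text \<open>The point with all its weight on \<open>v\<close> lies in the polyhedron of
  \<open>M\<close>, and the linear extension sends it to \<open>\<phi> v\<close>.\<close>

lemma vertex_position_in_realization:
  assumes M: "abstract_complex M" and v: "v \<in> vertices M"
    and bij: "bij_betw (linear_extension M \<phi>) (realization M) (realization K)"
  shows "\<phi> v \<in> realization K"
proof -
  define e where "e = (\<lambda>u. if u = v then 1 else (0::real))"
  have "{v} \<in> M" using M v by (auto simp: vertices_def abstract_complex_def)
  moreover have "{a. e a \<noteq> 0} = {v}" by (auto simp: e_def)
  ultimately have "e \<in> realization M"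
    using finite_vertices[OF M] v by (auto simp: realization_def e_def)
  moreover have "linear_extension M \<phi> e = \<phi> v"
    using finite_vertices[OF M] v
    by (auto simp: linear_extension_def e_def if_distrib[of "\<lambda>c. c * _"] cong: if_cong)
  ultimately show ?thesis using bij by (metis bij_betw_apply)
qed

text \<open>With too many vertices, the positions inside \<open>\<rho>\<close> would satisfy a
  nontrivial linear relation \<open>c\<close>. Moving along \<open>c\<close> from the barycenter of
  \<open>\<sigma>\<close> would leave the image point fixed, against injectivity.\<close>

lemma subdivision_simplex_card_le:
  assumes M: "abstract_complex M" and K: "abstract_complex K"
    and bij: "bij_betw (linear_extension M \<phi>) (realization M) (realization K)"
    and \<sigma>: "\<sigma> \<in> M" and \<rho>: "\<rho> \<in> K" "\<And>v. v \<in> \<sigma> \<Longrightarrow> {a. \<phi> v a \<noteq> 0} \<subseteq> \<rho>"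
  shows "card \<sigma> \<le> card \<rho>"
proof (rule ccontr)
  assume "\<not> card \<sigma> \<le> card \<rho>"
  then have lt: "card \<rho> < card \<sigma>" by simp
  have fin: "finite \<sigma>" "finite \<rho>" using M K \<sigma> \<rho> abstract_complex_finite by blast+
  have ne: "\<sigma> \<noteq> {}" using lt by auto
  obtain c where c: "\<exists>v\<in>\<sigma>. c v \<noteq> 0" "\<forall>a\<in>\<rho>. (\<Sum>v\<in>\<sigma>. c v * \<phi> v a) = 0"
    using homogeneous_system_nontrivial[OF fin(2,1) lt, of "\<lambda>a v. \<phi> v a"] by auto
  have c0: "(\<Sum>v\<in>\<sigma>. c v * \<phi> v a) = 0" for a
  proof (cases "a \<in> \<rho>")
    case False
    then have "\<phi> v a = 0" if "v \<in> \<sigma>" for v using \<rho>(2)[OF that] by auto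
    then show ?thesis by simp
  qed (use c in auto)
  have one: "(\<Sum>a\<in>\<rho>. \<phi> v a) = 1" if "v \<in> \<sigma>" for v
  proof -
    have "v \<in> vertices M" using that \<sigma> by (auto simp: vertices_def)
    then have "\<phi> v \<in> realization K" by (rule vertex_position_in_realization[OF M _ bij])
    then have "(\<Sum>a\<in>vertices K. \<phi> v a) = 1" by (simp add: realization_def)
    moreover have "(\<Sum>a\<in>vertices K. \<phi> v a) = (\<Sum>a\<in>\<rho>. \<phi> v a)"
      by (rule sum.mono_neutral_right) (use K finite_vertices \<rho> that in \<open>auto simp: vertices_def\<close>)
    ultimately show ?thesis by simp
  qed
  \<comment> \<open>Each position has coordinate sum 1, so adding up the relation over all
    coordinates shows that the coefficients sum to 0.\<close>
  have "(\<Sum>v\<in>\<sigma>. c v) = (\<Sum>v\<in>\<sigma>. \<Sum>a\<in>\<rho>. c v * \<phi> v a)"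
    by (simp add: one flip: sum_distrib_left)
  also have "\<dots> = 0" by (subst sum.swap) (simp add: c0)
  finally have csum: "(\<Sum>v\<in>\<sigma>. c v) = 0" .
  define m where "m = (\<Sum>v\<in>\<sigma>. \<bar>c v\<bar>) + 1"
  have cm: "\<bar>c v\<bar> < m" if "v \<in> \<sigma>" for v
    using member_le_sum[OF that, of "\<lambda>v. \<bar>c v\<bar>"] fin by (simp add: m_def)
  have m: "m > 0" using cm ne by fastforce
  \<comment> \<open>\<open>x 0\<close> is the barycenter of \<open>\<sigma>\<close>. Since
    \<open>m\<close> exceeds every \<open>\<bar>c v\<bar>\<close>, the coordinates stay positive for
    \<open>\<bar>s\<bar> \<le> 1\<close>.\<close>
  define x where "x = (\<lambda>s v. if v \<in> \<sigma> then (1 + s * c v / m) / card \<sigma> else (0::real))"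
  have pos: "x s v > 0" if "v \<in> \<sigma>" "\<bar>s\<bar> \<le> 1" for s v
  proof -
    have "\<bar>s * c v\<bar> \<le> 1 * \<bar>c v\<bar>" unfolding abs_mult by (rule mult_right_mono) (use that in auto)
    with cm[OF that(1)] have "\<bar>s * c v / m\<bar> < 1" using m by (simp add: abs_divide)
    then have "1 + s * c v / m > 0" by linarith
    moreover have "real (card \<sigma>) > 0" using lt by simp
    ultimately show ?thesis using that by (simp add: x_def)
  qed
  have nn: "x s v \<ge> 0" if "\<bar>s\<bar> \<le> 1" for s v
    using pos[OF _ that] by (cases "v \<in> \<sigma>") (auto simp: x_def less_imp_le)
  have xr: "x s \<in> realization M" if s: "\<bar>s\<bar> \<le> 1" for s
  proof -
    have "x s a \<noteq> 0 \<longleftrightarrow> a \<in> \<sigma>" for a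
    proof
      show "a \<in> \<sigma>" if "x s a \<noteq> 0" using that unfolding x_def by meson
      show "x s a \<noteq> 0" if "a \<in> \<sigma>" using pos[OF that s] by linarith
    qed
    then have "{a. x s a \<noteq> 0} = \<sigma>" by simp
    moreover have "(\<Sum>v\<in>vertices M. x s v) = (\<Sum>v\<in>\<sigma>. x s v)"
      using sum_realization_support[OF M \<sigma>, of "x s" "\<lambda>_. 1"] by (simp add: x_def)
    moreover have "(\<Sum>v\<in>\<sigma>. x s v) = (\<Sum>v\<in>\<sigma>. (1 + (s / m) * c v) / card \<sigma>)"
      by (rule sum.cong) (auto simp: x_def)
    moreover have "\<dots> = 1"
      unfolding sum_divide_distrib[symmetric] sum.distrib sum_distrib_left[symmetric] csum
      using lt by simp
    ultimately show ?thesis using \<sigma> nn[OF s] by (simp add: realization_def)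
  qed
  have "linear_extension M \<phi> (x s) = (\<lambda>a. (\<Sum>v\<in>\<sigma>. \<phi> v a) / card \<sigma>)" for s
  proof
    fix a
    have "linear_extension M \<phi> (x s) a = (\<Sum>v\<in>\<sigma>. x s v * \<phi> v a)"
      unfolding linear_extension_def by (rule sum_realization_support[OF M \<sigma>]) (simp add: x_def)
    also have "\<dots> = (\<Sum>v\<in>\<sigma>. (\<phi> v a + (s / m) * (c v * \<phi> v a)) / card \<sigma>)"
      by (rule sum.cong) (auto simp: x_def algebra_simps add_divide_distrib)
    also have "\<dots> = (\<Sum>v\<in>\<sigma>. \<phi> v a) / card \<sigma>"
      unfolding sum_divide_distrib[symmetric] sum.distrib sum_distrib_left[symmetric] c0 by simp
    finally show "linear_extension M \<phi> (x s) a = (\<Sum>v\<in>\<sigma>. \<phi> v a) / card \<sigma>" .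
  qed
  then have "linear_extension M \<phi> (x 0) = linear_extension M \<phi> (x 1)" by simp
  then have "x 0 = x 1"
    by (rule inj_onD[OF bij_betw_imp_inj_on[OF bij]]) (rule xr, simp)+
  moreover obtain v where v: "v \<in> \<sigma>" "c v \<noteq> 0" using c(1) by auto
  ultimately have "x 0 v = x 1 v" by simp
  then show False using v m lt by (simp add: x_def)
qed

text \<open>If every simplex of \<open>M\<close> had fewer vertices than \<open>\<rho>\<close>, its
  vertex positions would be annihilated by a nonzero linear functional \<open>l \<sigma>\<close> in
  the coordinates of \<open>\<rho>\<close>. Finitely many such hyperplanes cannot contain all of
  \<open>\<rho>\<close>, against surjectivity.\<close>

lemma subdivision_covers_card:
  assumes M: "abstract_complex M" and K: "abstract_complex K"
    and bij: "bij_betw (linear_extension M \<phi>) (realization M) (realization K)"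
    and \<rho>: "\<rho> \<in> K"
  shows "\<exists>\<sigma>\<in>M. card \<rho> \<le> card \<sigma>"
proof (rule ccontr)
  assume "\<not> ?thesis"
  then have small: "\<And>\<sigma>. \<sigma> \<in> M \<Longrightarrow> card \<sigma> < card \<rho>" by auto
  have fin: "finite \<rho>" using K \<rho> abstract_complex_finite by blast
  have "{} \<in> M" using M by (simp add: abstract_complex_def)
  then have ne: "\<rho> \<noteq> {}" using small by fastforce
  define n where "n = card \<rho>"
  obtain p where p: "bij_betw p \<rho> {..<n}"
    using ex_bij_betw_finite_nat[OF fin] by (auto simp: n_def atLeast0LessThan)
  define q where "q = inv_into \<rho> p"
  have q: "bij_betw q {..<n} \<rho>" unfolding q_def by (rule bij_betw_inv_into[OF p])
  have "\<exists>l. (\<exists>a\<in>\<rho>. l a \<noteq> 0) \<and> (\<forall>v\<in>\<sigma>. (\<Sum>a\<in>\<rho>. l a * \<phi> v a) = 0)" if "\<sigma> \<in> M" for \<sigma>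
    using homogeneous_system_nontrivial[OF _ fin small[OF that], of \<phi>]
      abstract_complex_finite[OF M that] by auto
  then obtain l where l: "\<And>\<sigma>. \<sigma> \<in> M \<Longrightarrow> \<exists>a\<in>\<rho>. l \<sigma> a \<noteq> 0"
    "\<And>\<sigma> v. \<sigma> \<in> M \<Longrightarrow> v \<in> \<sigma> \<Longrightarrow> (\<Sum>a\<in>\<rho>. l \<sigma> a * \<phi> v a) = 0" by metis
  \<comment> \<open>The parameters at which \<open>l \<sigma>\<close> vanishes on the curve with
    coordinates \<open>t ^ p a\<close>. The enumeration \<open>p\<close> makes the exponents
    distinct, so for \<open>\<sigma> \<in> M\<close> these are the roots of a nonzero
    polynomial.\<close>
  define Z where "Z = (\<lambda>\<sigma>. {t::real. (\<Sum>i\<le>n-1. l \<sigma> (q i) * t ^ i) = 0})"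
  \<comment> \<open>The truncated subtraction is harmless because \<open>\<rho>\<close> is
    nonempty.\<close>
  have lam: "{..n-1} = {..<n}" using ne fin by (cases n) (auto simp: n_def)
  have finZ: "finite (Z \<sigma>)" if "\<sigma> \<in> M" for \<sigma>
  proof -
    from l(1)[OF that] obtain a where "a \<in> \<rho>" "l \<sigma> a \<noteq> 0" by auto
    then have "\<exists>i\<in>{..<n}. l \<sigma> (q i) \<noteq> 0" using q by (metis bij_betw_iff_bijections)
    then have "\<exists>i\<le>n-1. l \<sigma> (q i) \<noteq> 0" unfolding lam[symmetric] by auto
    then show ?thesis unfolding Z_def using polyfun_finite_roots[of "\<lambda>i. l \<sigma> (q i)" "n-1"] by blast
  qed
  \<comment> \<open>Points on a moment curve inside \<open>\<rho>\<close>: a linear functional vanishing on one of the smaller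
    simplices vanishes at only finitely many of them.\<close>
  have cover: "t \<in> (\<Union>\<sigma>\<in>M. Z \<sigma>)" if t: "t > 0" for t
  proof -
    \<comment> \<open>Dividing by \<open>N\<close> moves the point of the curve into the simplex,
      with full support \<open>\<rho>\<close>; the vanishing of a linear functional is unaffected by
      this scaling.\<close>
    define N where "N = (\<Sum>a\<in>\<rho>. t ^ p a)"
    have N: "N > 0" unfolding N_def by (rule sum_pos) (use fin ne t in auto)
    define y where "y = (\<lambda>a. if a \<in> \<rho> then t ^ p a / N else 0)"
    have supp: "{a. y a \<noteq> 0} = \<rho>" using N t by (auto simp: y_def)
    have "(\<Sum>a\<in>vertices K. y a) = (\<Sum>a\<in>\<rho>. y a)"
      by (rule sum.mono_neutral_right) (use K finite_vertices \<rho> in \<open>auto simp: vertices_def y_def\<close>)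
    also have "\<dots> = (\<Sum>a\<in>\<rho>. t ^ p a / N)" by (rule sum.cong) (auto simp: y_def)
    also have "\<dots> = 1" using N by (simp add: N_def flip: sum_divide_distrib)
    finally have "y \<in> realization K" using supp \<rho> N t by (auto simp: realization_def y_def)
    then obtain x where x: "x \<in> realization M" "linear_extension M \<phi> x = y"
      using bij by (metis bij_betw_iff_bijections)
    define \<sigma> where "\<sigma> = {v. x v \<noteq> 0}"
    have \<sigma>: "\<sigma> \<in> M" using x by (simp add: \<sigma>_def realization_def)
    have y: "y a = (\<Sum>v\<in>\<sigma>. x v * \<phi> v a)" for a
      using x(2) sum_realization_support[OF M \<sigma>, of x "\<lambda>v. \<phi> v a"]
      by (auto simp: linear_extension_def \<sigma>_def)
    have "(\<Sum>a\<in>\<rho>. l \<sigma> a * y a) = (\<Sum>a\<in>\<rho>. \<Sum>v\<in>\<sigma>. x v * (l \<sigma> a * \<phi> v a))"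
      unfolding y by (simp add: sum_distrib_left mult_ac)
    also have "\<dots> = (\<Sum>v\<in>\<sigma>. x v * (\<Sum>a\<in>\<rho>. l \<sigma> a * \<phi> v a))"
      by (subst sum.swap) (simp add: sum_distrib_left)
    also have "\<dots> = 0" using l(2)[OF \<sigma>] by simp
    finally have "(\<Sum>a\<in>\<rho>. l \<sigma> a * t ^ p a) / N = 0"
      unfolding sum_divide_distrib by (simp add: y_def cong: sum.cong)
    then have "(\<Sum>a\<in>\<rho>. l \<sigma> a * t ^ p a) = 0" using N by simp
    moreover have "(\<Sum>i\<in>{..<n}. l \<sigma> (q i) * t ^ p (q i)) = (\<Sum>a\<in>\<rho>. l \<sigma> a * t ^ p a)"
      by (rule sum.reindex_bij_betw[OF q])
    moreover have "p (q i) = i" if "i < n" for i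
      unfolding q_def using p that by (simp add: bij_betw_inv_into_right)
    ultimately have "t \<in> Z \<sigma>" unfolding Z_def lam by (simp add: lam)
    with \<sigma> show ?thesis by blast
  qed
  have "finite (\<Union>\<sigma>\<in>M. Z \<sigma>)" using M finZ by (auto simp: abstract_complex_def)
  then have "finite {0::real<..}" by (rule finite_subset[rotated]) (use cover in auto)
  then show False using infinite_Ioi by blast
qed

lemma subdivision_complex_dim:
  assumes "is_subdivision M K"
  shows "complex_dim M = complex_dim K"
proof -
  obtain \<phi> where M: "abstract_complex M" and K: "abstract_complex K"
    and \<phi>: "\<forall>\<sigma>\<in>M. \<exists>\<rho>\<in>K. \<forall>v\<in>\<sigma>. {a. \<phi> v a \<noteq> 0} \<subseteq> \<rho>"
    and bij: "bij_betw (linear_extension M \<phi>) (realization M) (realization K)"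
    using assms unfolding is_subdivision_def by blast
  show ?thesis
  proof (rule antisym)
    show "complex_dim M \<le> complex_dim K"
    proof (rule complex_dim_mono[OF M K])
      fix \<sigma> assume \<sigma>: "\<sigma> \<in> M"
      then obtain \<rho> where "\<rho> \<in> K" "\<forall>v\<in>\<sigma>. {a. \<phi> v a \<noteq> 0} \<subseteq> \<rho>" using \<phi> by blast
      then show "\<exists>\<rho>\<in>K. card \<sigma> \<le> card \<rho>"
        using subdivision_simplex_card_le[OF M K bij \<sigma>] by blast
    qed
    show "complex_dim K \<le> complex_dim M"
      by (rule complex_dim_mono[OF K M]) (rule subdivision_covers_card[OF M K bij])
  qed
qed

section \<open>Relabelled complexes as subdivisions\<close>

lemma abstract_complex_image:
  assumes "abstract_complex K"
  shows "abstract_complex ((`) f ` K)"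
proof -
  have "\<rho> \<in> (`) f ` K" if \<sigma>: "\<sigma> \<in> K" and "\<rho> \<subseteq> f ` \<sigma>" for \<rho> \<sigma>
  proof -
    obtain \<xi> where "\<xi> \<subseteq> \<sigma>" "\<rho> = f ` \<xi>" using \<open>\<rho> \<subseteq> f ` \<sigma>\<close> by (meson subset_imageE)
    then show ?thesis using abstract_complex_subset[OF assms \<sigma>] by blast
  qed
  moreover have "finite ((`) f ` K)" "{} \<in> (`) f ` K" "\<And>\<sigma>. \<sigma> \<in> K \<Longrightarrow> finite (f ` \<sigma>)"
    using assms by (simp_all add: abstract_complex_def)
  ultimately show ?thesis unfolding abstract_complex_def by blast
qed

lemma vertices_image: "vertices ((`) f ` K) = f ` vertices K"
  by (auto simp: vertices_def)

text \<open>The new vertex \<open>f a\<close> is placed at the unit vector of \<open>a\<close>. The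
  linear extension is then composition with \<open>f\<close>, inverted by composition with
  \<open>g\<close>, both extended by zero. This supplies the subdivisions on natural numbers that
  balls, spheres and collapsibility ask for.\<close>

lemma relabelling_is_subdivision:
  assumes K: "abstract_complex K" and inj: "inj_on f (vertices K)"
  shows "is_subdivision ((`) f ` K) K"
proof -
  let ?M = "(`) f ` K"
  define g where "g = inv_into (vertices K) f"
  have g: "g (f a) = a" if "a \<in> vertices K" for a using that inj by (simp add: g_def)
  have finV: "finite (vertices K)" by (rule finite_vertices[OF K])
  have sub: "\<sigma> \<subseteq> vertices K" if "\<sigma> \<in> K" for \<sigma> using that by (auto simp: vertices_def)
  define \<phi> where "\<phi> = (\<lambda>v a. if a = g v then 1 else (0::real))"
  have lin: "linear_extension ?M \<phi> x = (\<lambda>a. if a \<in> vertices K then x (f a) else 0)" for x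
  proof
    fix a
    have "linear_extension ?M \<phi> x a = (\<Sum>v\<in>vertices K. x (f v) * \<phi> (f v) a)"
      unfolding linear_extension_def vertices_image using inj by (simp add: sum.reindex)
    also have "\<dots> = (\<Sum>v\<in>vertices K. if v = a then x (f v) else 0)"
      by (rule sum.cong) (auto simp: \<phi>_def g)
    also have "\<dots> = (if a \<in> vertices K then x (f a) else 0)" using finV by simp
    finally show "linear_extension ?M \<phi> x a = (if a \<in> vertices K then x (f a) else 0)" .
  qed
  have zero: "x u = 0" if "x \<in> realization L" "u \<notin> vertices L" for L :: "'c set set" and x u
    using that by (auto simp: realization_def vertices_def)
  have "bij_betw (linear_extension ?M \<phi>) (realization ?M) (realization K)"
  proof (rule bij_betw_byWitness[where f' = "\<lambda>y v. if v \<in> f ` vertices K then y (g v) else 0"])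
    show "\<forall>x\<in>realization ?M. (\<lambda>v. if v \<in> f ` vertices K then linear_extension ?M \<phi> x (g v) else 0) = x"
      unfolding lin using zero[of _ ?M] by (auto simp: fun_eq_iff vertices_image g)
    show "\<forall>y\<in>realization K. linear_extension ?M \<phi> (\<lambda>v. if v \<in> f ` vertices K then y (g v) else 0) = y"
      unfolding lin using zero[of _ K] by (auto simp: fun_eq_iff g)
    show "linear_extension ?M \<phi> ` realization ?M \<subseteq> realization K"
    proof (rule image_subsetI)
      fix x assume x: "x \<in> realization ?M"
      then obtain \<sigma> where \<sigma>: "\<sigma> \<in> K" "{v. x v \<noteq> 0} = f ` \<sigma>" by (auto simp: realization_def)
      have "{a. linear_extension ?M \<phi> x a \<noteq> 0} = {a \<in> vertices K. f a \<in> f ` \<sigma>}"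
        using \<sigma> by (auto simp: lin)
      also have "\<dots> = \<sigma>" using sub[OF \<sigma>(1)] inj by (auto simp: inj_on_def)
      finally have "{a. linear_extension ?M \<phi> x a \<noteq> 0} \<in> K" using \<sigma> by simp
      moreover have "(\<Sum>a\<in>vertices K. linear_extension ?M \<phi> x a) = (\<Sum>v\<in>vertices ?M. x v)"
        using inj by (simp add: lin vertices_image sum.reindex)
      ultimately show "linear_extension ?M \<phi> x \<in> realization K"
        using x by (simp add: realization_def) (simp add: lin)
    qed
    show "(\<lambda>y v. if v \<in> f ` vertices K then y (g v) else 0) ` realization K \<subseteq> realization ?M"
    proof (rule image_subsetI)
      fix y assume y: "y \<in> realization K"
      let ?x = "\<lambda>v. if v \<in> f ` vertices K then y (g v) else 0"
      have "{v. ?x v \<noteq> 0} = f ` {a. y a \<noteq> 0}"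
        using zero[OF y] g by (auto split: if_splits) (metis imageI mem_Collect_eq)
      moreover have "(\<Sum>v\<in>vertices ?M. ?x v) = (\<Sum>a\<in>vertices K. y a)"
        unfolding vertices_image using inj by (simp add: sum.reindex g)
      ultimately show "?x \<in> realization ?M" using y by (simp add: realization_def)
    qed
  qed
  moreover have "\<exists>\<rho>\<in>K. \<forall>v\<in>\<tau>. {a. \<phi> v a \<noteq> 0} \<subseteq> \<rho>" if "\<tau> \<in> ?M" for \<tau>
  proof -
    from that obtain \<sigma> where "\<sigma> \<in> K" "\<tau> = f ` \<sigma>" by auto
    then show ?thesis using sub[of \<sigma>] by (intro bexI[of _ \<sigma>]) (auto simp: \<phi>_def g subset_iff)
  qed
  ultimately show ?thesis
    using K abstract_complex_image[OF K, of f] unfolding is_subdivision_def by blast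
qed

section \<open>Balls, spheres and collapses\<close>

lemma abstract_complex_Pow: "finite F \<Longrightarrow> abstract_complex (Pow F)"
  unfolding abstract_complex_def by (simp add: finite_subset) (meson Pow_iff subset_trans finite_subset)

lemma vertices_Pow [simp]: "vertices (Pow F) = F"
  by (auto simp: vertices_def)

lemma complex_dim_Pow:
  assumes "finite F" shows "complex_dim (Pow F) = int (card F) - 1"
proof -
  obtain \<sigma> where "\<sigma> \<in> Pow F" "int (card \<sigma>) - 1 = complex_dim (Pow F)"
    using complex_dim_attained[OF abstract_complex_Pow[OF assms]] by blast
  moreover from this have "card \<sigma> \<le> card F" using assms by (auto intro: card_mono)
  ultimately show ?thesis
    using complex_dim_ge[OF abstract_complex_Pow[OF assms], of F] by simp
qed

text \<open>The common subdivision transports the dimension from the standard simplex to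
  \<open>L\<close>.\<close>

lemma combinatorial_ballD:
  assumes "combinatorial_ball k L"
  shows "abstract_complex L" "complex_dim L = k"
proof -
  from assms obtain M :: "nat set set" where k: "0 \<le> k"
    and M: "is_subdivision M L" "is_subdivision M (std_simplex k)"
    by (auto simp: combinatorial_ball_def common_subdivision_def)
  then show "abstract_complex L" by (auto simp: is_subdivision_def)
  show "complex_dim L = k"
    using M[THEN subdivision_complex_dim] k by (simp add: std_simplex_def complex_dim_Pow)
qed

lemma image_Pow_bij: "bij_betw f A B \<Longrightarrow> (`) f ` Pow A = Pow B"
  by (rule image_Pow_surj[OF bij_betw_imp_surj_on])

text \<open>The simplex on the naturals below \<open>card F\<close> relabels both \<open>F\<close>
  and the standard simplex, hence is a common subdivision.\<close>

lemma combinatorial_ball_Pow: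
  fixes F :: "'a set"
  assumes "finite F" "F \<noteq> {}"
  shows "combinatorial_ball (int (card F) - 1) (Pow F)"
proof -
  let ?d = "int (card F) - 1"
  have card: "card F > 0" using assms by (simp add: card_gt_0_iff)
  obtain f where f: "bij_betw f F {..<card F}"
    using ex_bij_betw_finite_nat[OF assms(1)] by (auto simp: atLeast0LessThan)
  have g: "bij_betw nat {0..?d} {..<card F}"
    by (rule bij_betw_byWitness[where f' = int]) (use card in auto)
  have "is_subdivision (Pow {..<card F}) (Pow F)"
    using relabelling_is_subdivision[OF abstract_complex_Pow[OF assms(1)], of f]
    by (simp add: image_Pow_bij[OF f] bij_betw_imp_inj_on[OF f])
  moreover have "is_subdivision (Pow {..<card F}) (std_simplex ?d)"
    using relabelling_is_subdivision[OF abstract_complex_Pow, of "{0..?d}" nat]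
    by (simp add: image_Pow_bij[OF g] bij_betw_imp_inj_on[OF g] std_simplex_def)
  ultimately show ?thesis
    using card by (auto simp: combinatorial_ball_def common_subdivision_def)
qed

text \<open>\<open>F\<close> is its only face of full cardinality, so each ridge
  \<open>F - {v}\<close> lies in exactly one top simplex, and every proper face lies in some
  ridge.\<close>

lemma complex_boundary_Pow:
  assumes "finite F" "F \<noteq> {}"
  shows "complex_boundary (Pow F) = {\<sigma>. \<sigma> \<subset> F}"
proof -
  have card: "card F > 0" using assms by (simp add: card_gt_0_iff)
  have top: "\<eta> = F" if "\<eta> \<subseteq> F" "card \<eta> = card F" for \<eta>
    using that assms by (simp add: card_subset_eq)
  show ?thesis
  proof (intro equalityI subsetI)
    fix \<sigma> assume "\<sigma> \<in> complex_boundary (Pow F)"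
    then obtain \<rho> where "\<rho> \<subseteq> F" "\<sigma> \<subseteq> \<rho>" "int (card \<rho>) = int (card F) - 1"
      unfolding complex_boundary_def complex_dim_Pow[OF assms(1)] simplex_dim_def by force
    then have "\<rho> \<noteq> F" "\<rho> \<subseteq> F" "\<sigma> \<subseteq> \<rho>" by auto
    then show "\<sigma> \<in> {\<sigma>. \<sigma> \<subset> F}" by blast
  next
    fix \<sigma> assume "\<sigma> \<in> {\<sigma>. \<sigma> \<subset> F}"
    then obtain v where v: "v \<in> F" "\<sigma> \<subseteq> F - {v}" by blast
    have "\<exists>!\<eta>. \<eta> \<in> Pow F \<and> simplex_dim \<eta> = complex_dim (Pow F) \<and> F - {v} \<subseteq> \<eta>"
      unfolding complex_dim_Pow[OF assms(1)] simplex_dim_def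
    proof (rule ex1I[of _ F])
      fix \<eta> assume "\<eta> \<in> Pow F \<and> int (card \<eta>) - 1 = int (card F) - 1 \<and> F - {v} \<subseteq> \<eta>"
      then show "\<eta> = F" using top[of \<eta>] by simp
    qed auto
    moreover have "simplex_dim (F - {v}) = complex_dim (Pow F) - 1"
      using v assms card by (simp add: complex_dim_Pow[OF assms(1)] simplex_dim_def of_nat_diff)
    moreover have "F - {v} \<in> Pow F" by blast
    ultimately show "\<sigma> \<in> complex_boundary (Pow F)"
      unfolding complex_boundary_def by (intro CollectI bexI[of _ "F - {v}"] conjI v(2))
  qed
qed

lemma boundary_std_simplex_1: "complex_boundary (std_simplex 1) = {{}, {0}, {1}}"
proof -
  have "{0..1::int} = {0, 1}" by auto
  then have "std_simplex 1 = Pow {0, 1}" by (simp add: std_simplex_def)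
  then have "complex_boundary (std_simplex 1) = Pow {0, 1} - {{0, 1}}"
    by (simp only: complex_boundary_Pow finite.intros insert_not_empty not_False_eq_True) blast
  also have "\<dots> = {{}, {0}, {1}}" by (simp add: Pow_insert) blast
  finally show ?thesis .
qed

lemma abstract_complex_two_points: "abstract_complex {{}, {a}, {b}}"
  by (auto simp: abstract_complex_def subset_singleton_iff)

lemma combinatorial_sphere_0D:
  assumes "combinatorial_sphere 0 S"
  shows "abstract_complex S" "complex_dim S = 0"
proof -
  from assms obtain M :: "nat set set" where
    M: "is_subdivision M S" "is_subdivision M {{}, {0}, {1::int}}"
    by (auto simp: combinatorial_sphere_def common_subdivision_def boundary_std_simplex_1)
  then show "abstract_complex S" by (auto simp: is_subdivision_def)
  show "complex_dim S = 0"
    using M[THEN subdivision_complex_dim] by (simp add: complex_dim_def simplex_dim_def)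
qed

lemma combinatorial_sphere_two_points:
  assumes "a \<noteq> b"
  shows "combinatorial_sphere 0 {{}, {a}, {b}}"
proof -
  have "is_subdivision ((`) (\<lambda>x. if x = a then 0 else 1::nat) ` {{}, {a}, {b}}) {{}, {a}, {b}}"
    by (rule relabelling_is_subdivision[OF abstract_complex_two_points])
      (use assms in \<open>auto simp: vertices_def inj_on_def\<close>)
  moreover have "is_subdivision ((`) nat ` {{}, {0}, {1}}) {{}, {0}, {1::int}}"
    by (rule relabelling_is_subdivision[OF abstract_complex_two_points])
      (auto simp: vertices_def inj_on_def)
  ultimately show ?thesis
    using assms
    by (auto simp: combinatorial_sphere_def common_subdivision_def boundary_std_simplex_1)
qed

section \<open>Principal simplices and ridges\<close>

lemma principal_above:
  assumes "abstract_complex K" "\<sigma> \<in> K"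
  obtains \<eta> where "\<eta> \<in> principal_simplices K" "\<sigma> \<subseteq> \<eta>"
proof -
  have "finite K" using assms by (simp add: abstract_complex_def)
  from finite_has_maximal2[OF this assms(2)] obtain \<eta>
    where "\<eta> \<in> K" "\<sigma> \<subseteq> \<eta>" "\<forall>b\<in>K. \<eta> \<subseteq> b \<longrightarrow> \<eta> = b" by blast
  with that show thesis by (auto simp: principal_simplices_def)
qed

lemma principal_in: "\<sigma> \<in> principal_simplices K \<Longrightarrow> \<sigma> \<in> K"
  by (simp add: principal_simplices_def)

lemma principal_maximal:
  "\<sigma> \<in> principal_simplices K \<Longrightarrow> \<rho> \<in> K \<Longrightarrow> \<sigma> \<subseteq> \<rho> \<Longrightarrow> \<sigma> = \<rho>"
  by (auto simp: principal_simplices_def)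

lemma principal_if_top_dim:
  assumes "abstract_complex K" "\<sigma> \<in> K" "simplex_dim \<sigma> = complex_dim K"
  shows "\<sigma> \<in> principal_simplices K"
proof -
  have False if \<rho>: "\<rho> \<in> K" "\<sigma> \<subset> \<rho>" for \<rho>
  proof -
    have "card \<sigma> < card \<rho>"
      using \<rho> abstract_complex_finite[OF assms(1)] by (simp add: psubset_card_mono)
    with assms complex_dim_ge[OF assms(1) \<rho>(1)] show False by (simp add: simplex_dim_def)
  qed
  then show ?thesis using assms(2) unfolding principal_simplices_def by blast
qed

text \<open>\<open>G\<close> is too large to lie in \<open>\<partial>L\<close>, hence is not in
  \<open>B\<close>. A ridge of \<open>G\<close> either lies in a second top simplex of
  \<open>L\<close> or belongs to \<open>\<partial>L\<close> and so to \<open>B\<close>; in the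
  latter case a principal simplex of \<open>B\<close> above it differs from
  \<open>G\<close>.\<close>

lemma ridge_in_other_principal:
  assumes "top_generated B S" "top_generated L S" "B \<inter> L = complex_boundary L"
    and G: "G \<in> L" "simplex_dim G = complex_dim L"
  shows "G \<in> principal_simplices S" "G \<notin> B"
    and "v \<in> G \<Longrightarrow> \<exists>Q\<in>principal_simplices S. G - {v} \<subseteq> Q \<and> Q \<noteq> G"
proof -
  have B: "abstract_complex B" "principal_simplices B \<subseteq> principal_simplices S"
    and L: "abstract_complex L" "principal_simplices L \<subseteq> principal_simplices S"
    using assms by (auto simp: top_generated_def)
  show "G \<in> principal_simplices S" using principal_if_top_dim[OF L(1) G] L(2) by blast
  have finG: "finite G" using L G abstract_complex_finite by blast
  show GB: "G \<notin> B"
  proof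
    assume "G \<in> B"
    then have "G \<in> complex_boundary L" using G assms(3) by blast
    then obtain \<rho> where \<rho>: "\<rho> \<in> L" "G \<subseteq> \<rho>" "simplex_dim \<rho> = complex_dim L - 1"
      by (auto simp: complex_boundary_def)
    then have "card G \<le> card \<rho>" using L abstract_complex_finite by (blast intro: card_mono)
    with \<rho> G show False by (simp add: simplex_dim_def)
  qed
  assume v: "v \<in> G"
  have GvL: "G - {v} \<in> L" using abstract_complex_subset[OF L(1) G(1)] by blast
  have "card G > 0" using v finG by (auto simp: card_gt_0_iff)
  then have dim: "simplex_dim (G - {v}) = complex_dim L - 1"
    using v finG G(2) by (simp add: simplex_dim_def of_nat_diff)
  show "\<exists>Q\<in>principal_simplices S. G - {v} \<subseteq> Q \<and> Q \<noteq> G"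
  proof (cases "\<exists>!\<eta>. \<eta> \<in> L \<and> simplex_dim \<eta> = complex_dim L \<and> G - {v} \<subseteq> \<eta>")
    case True
    then have "G - {v} \<in> complex_boundary L"
      unfolding complex_boundary_def by (intro CollectI bexI[OF _ GvL] conjI subset_refl dim)
    then have "G - {v} \<in> B" using assms(3) by blast
    then obtain \<eta> where "\<eta> \<in> principal_simplices B" "G - {v} \<subseteq> \<eta>"
      using principal_above[OF B(1)] by blast
    then show ?thesis using B GB principal_in by blast
  next
    case False
    moreover have "G \<in> L \<and> simplex_dim G = complex_dim L \<and> G - {v} \<subseteq> G" using G by auto
    ultimately obtain \<eta> where "\<eta> \<in> L" "simplex_dim \<eta> = complex_dim L" "G - {v} \<subseteq> \<eta>" "\<eta> \<noteq> G"
      by metis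
    then show ?thesis using principal_if_top_dim[OF L(1)] L(2) by blast
  qed
qed

section \<open>Connectedness and collapsibility\<close>

text \<open>Connectedness, phrased by a two-colouring \<open>c\<close> that is constant on
  simplices. A vertex \<open>u\<close> lost in an elementary collapse is the free face itself; the
  simplex \<open>\<eta>\<close> above it has a further vertex \<open>w\<close>, which survives and
  has the same colour.\<close>

lemma collapses_to_point_connected:
  assumes "collapses_to K {{}, {p}}"
    and "\<And>\<sigma> \<rho>. \<sigma> \<in> K \<Longrightarrow> \<rho> \<subseteq> \<sigma> \<Longrightarrow> \<rho> \<in> K"
    and "\<And>\<sigma> u v. \<sigma> \<in> K \<Longrightarrow> u \<in> \<sigma> \<Longrightarrow> v \<in> \<sigma> \<Longrightarrow> c u \<longleftrightarrow> c v"
    and "u \<in> vertices K"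
  shows "c u \<longleftrightarrow> c p"
  using assms unfolding collapses_to_def
proof (induction arbitrary: u rule: converse_rtranclp_induct)
  case base
  then show ?case by (auto simp: vertices_def)
next
  case (step K L)
  then obtain \<sigma> \<eta> where \<sigma>: "\<sigma> \<in> K" "\<eta> \<in> K" "\<sigma> \<noteq> {}" "\<sigma> \<subset> \<eta>" "\<forall>\<rho>\<in>K. \<sigma> \<subset> \<rho> \<longrightarrow> \<rho> = \<eta>"
    and L: "L = K - {\<sigma>, \<eta>}" unfolding elementary_collapse_def by blast
  have down: "\<rho> \<in> L" if "\<xi> \<in> L" "\<rho> \<subseteq> \<xi>" for \<xi> \<rho>
  proof -
    have "\<rho> \<in> K" using that L step.prems(1) by blast
    moreover have "\<rho> \<noteq> \<sigma>" using that \<sigma>(5) L by blast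
    moreover have "\<rho> \<noteq> \<eta>" using that \<sigma>(4,5) L by blast
    ultimately show ?thesis using L by blast
  qed
  have IH: "c x \<longleftrightarrow> c p" if "x \<in> vertices L" for x
    by (rule step.IH[OF down _ that]) (use step.prems(2) L in blast)+
  have single: "{u} \<in> K" using step.prems(1,3) by (auto simp: vertices_def)
  show ?case
  proof (cases "{u} \<in> L")
    case True
    then show ?thesis using IH by (auto simp: vertices_def)
  next
    case False
    then have "\<sigma> = {u}" using single \<sigma>(3,4) L by (auto simp: subset_singleton_iff psubset_eq)
    moreover obtain w where w: "w \<in> \<eta>" "w \<notin> \<sigma>" using \<sigma>(4) by blast
    ultimately have "{w} \<in> L" using step.prems(1)[OF \<sigma>(2), of "{w}"] \<sigma>(3,4) L by auto
    then have "c w \<longleftrightarrow> c p" using IH by (auto simp: vertices_def)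
    moreover have "c u \<longleftrightarrow> c w" using step.prems(2)[OF \<sigma>(2)] w \<sigma> \<open>\<sigma> = {u}\<close> by blast
    ultimately show ?thesis by simp
  qed
qed

text \<open>A vertex of the subdivision \<open>M\<close> is coloured by whether its position lies in
  \<open>X\<close>. Simplices of \<open>M\<close> lie over \<open>X\<close> or over
  \<open>Y\<close>, so the colour is constant on each of them and, by connectedness, on
  \<open>M\<close>; but both colours occur.\<close>

lemma disjoint_simplices_not_collapsible:
  assumes "X \<inter> Y = {}" "X \<noteq> {}" "Y \<noteq> {}"
  shows "\<not> collapsible (Pow X \<union> Pow Y)"
proof
  let ?K = "Pow X \<union> Pow Y"
  assume "collapsible ?K"
  then obtain M :: "nat set set" and p \<phi> where M: "abstract_complex M" and K: "abstract_complex ?K"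
    and \<phi>: "\<And>\<sigma>. \<sigma> \<in> M \<Longrightarrow> \<exists>\<rho>\<in>?K. \<forall>v\<in>\<sigma>. {a. \<phi> v a \<noteq> 0} \<subseteq> \<rho>"
    and bij: "bij_betw (linear_extension M \<phi>) (realization M) (realization ?K)"
    and col: "collapses_to M {{}, {p}}"
    unfolding collapsible_def is_subdivision_def by (elim exE conjE) (rule that; simp)
  define c where "c = (\<lambda>v. {a. \<phi> v a \<noteq> 0} \<subseteq> X)"
  \<comment> \<open>A position has a nonempty support, so it cannot lie over both of the disjoint
    sets \<open>X\<close> and \<open>Y\<close>.\<close>
  have nz: "{a. \<phi> v a \<noteq> 0} \<noteq> {}" if "v \<in> vertices M" for v
  proof
    assume "{a. \<phi> v a \<noteq> 0} = {}"
    then have "(\<Sum>a\<in>vertices ?K. \<phi> v a) = 0" by simp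
    then show False
      using vertex_position_in_realization[OF M that bij] by (simp add: realization_def)
  qed
  have cc: "c u \<longleftrightarrow> c v" if "\<sigma> \<in> M" "u \<in> \<sigma>" "v \<in> \<sigma>" for \<sigma> u v
  proof -
    have "u \<in> vertices M" "v \<in> vertices M" using that by (auto simp: vertices_def)
    moreover obtain \<rho> where "\<rho> \<in> ?K" "{a. \<phi> u a \<noteq> 0} \<subseteq> \<rho>" "{a. \<phi> v a \<noteq> 0} \<subseteq> \<rho>"
      using \<phi>[OF \<open>\<sigma> \<in> M\<close>] \<open>u \<in> \<sigma>\<close> \<open>v \<in> \<sigma>\<close> by blast
    ultimately show ?thesis using nz[of u] nz[of v] assms(1) unfolding c_def by blast
  qed
  have const: "c u \<longleftrightarrow> c p" if "u \<in> vertices M" for u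
    by (rule collapses_to_point_connected[where c = c, OF col _ _ that])
      (rule abstract_complex_subset[OF M] cc; assumption)+
  \<comment> \<open>The vertex \<open>x\<close>, as the point \<open>e\<close> of the polyhedron, is
    an image point; some vertex of \<open>M\<close> must therefore contribute to its coordinate at
    \<open>x\<close>.\<close>
  have hit: "\<exists>v\<in>vertices M. \<phi> v x \<noteq> 0" if x: "x \<in> X \<union> Y" for x
  proof -
    define e where "e = (\<lambda>a. if a = x then 1 else (0::real))"
    have "{a. e a \<noteq> 0} = {x}" by (auto simp: e_def)
    moreover have "{x} \<in> ?K" using x by auto
    moreover have "(\<Sum>a\<in>vertices ?K. e a) = 1"
      using finite_vertices[OF K] x by (auto simp: e_def vertices_def)
    ultimately have "e \<in> realization ?K" by (simp add: realization_def) (simp add: e_def)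
    then obtain z where "linear_extension M \<phi> z = e" using bij by (metis bij_betw_iff_bijections)
    then have "(\<Sum>v\<in>vertices M. z v * \<phi> v x) = 1" by (auto simp: linear_extension_def e_def fun_eq_iff)
    then have "(\<Sum>v\<in>vertices M. z v * \<phi> v x) \<noteq> 0" by simp
    then show ?thesis by (rule contrapos_np) (rule sum.neutral, auto)
  qed
  obtain x y where xy: "x \<in> X" "y \<in> Y" using assms by blast
  obtain u where u: "u \<in> vertices M" "\<phi> u x \<noteq> 0" using hit xy by blast
  obtain v where v: "v \<in> vertices M" "\<phi> v y \<noteq> 0" using hit xy by blast
  obtain \<sigma> where \<sigma>: "\<sigma> \<in> M" "u \<in> \<sigma>" using u by (auto simp: vertices_def)
  from \<phi>[OF \<sigma>(1)] obtain \<rho> where "\<rho> \<in> ?K" "\<forall>v\<in>\<sigma>. {a. \<phi> v a \<noteq> 0} \<subseteq> \<rho>" ..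
  with \<sigma>(2) have \<rho>: "\<rho> \<in> ?K" "{a. \<phi> u a \<noteq> 0} \<subseteq> \<rho>" by simp_all
  then have "x \<in> \<rho>" using u by auto
  then have "\<rho> \<subseteq> X" using \<rho>(1) xy assms(1) by auto
  then have "c u" using \<rho>(2) by (simp add: c_def)
  moreover have "\<not> c v"
  proof
    assume "c v"
    then have "y \<in> X" using v(2) by (auto simp: c_def)
    then show False using xy assms(1) by blast
  qed
  ultimately show False using const u v by blast
qed

text \<open>Induction on the base \<open>X\<close>. A maximal nonempty \<open>\<sigma>\<close> of
  \<open>X\<close> is a free face of \<open>insert w \<sigma>\<close>, and removing this pair leaves
  the cone over \<open>X - {\<sigma>}\<close>.\<close>

lemma cone_collapses_to_apex:
  assumes "finite X" "\<And>\<sigma>. \<sigma> \<in> X \<Longrightarrow> finite \<sigma> \<and> w \<notin> \<sigma>" "{} \<in> X"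
    and "\<And>\<sigma> \<rho>. \<sigma> \<in> X \<Longrightarrow> \<rho> \<subseteq> \<sigma> \<Longrightarrow> \<rho> \<in> X"
  shows "collapses_to (X \<union> insert w ` X) {{}, {w}}"
  using assms
proof (induction X rule: finite_remove_induct)
  case empty
  then show ?case by simp
next
  case (remove X)
  show ?case
  proof (cases "X = {{}}")
    case True
    then show ?thesis by (simp add: collapses_to_def insert_commute)
  next
    case False
    then obtain \<rho> where "\<rho> \<in> X" "\<rho> \<noteq> {}" using remove.prems(2) by blast
    then obtain \<sigma> where \<sigma>: "\<sigma> \<in> X" "\<rho> \<subseteq> \<sigma>" "\<forall>b\<in>X. \<sigma> \<subseteq> b \<longrightarrow> \<sigma> = b"
      using finite_has_maximal2[OF \<open>finite X\<close>] by blast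
    have ne: "\<sigma> \<noteq> {}" using \<sigma> \<open>\<rho> \<noteq> {}\<close> by blast
    have w: "w \<notin> \<xi>" if "\<xi> \<in> X" for \<xi> using remove.prems(1) that by blast
    let ?K = "X \<union> insert w ` X" and ?L = "(X - {\<sigma>}) \<union> insert w ` (X - {\<sigma>})"
    have L: "?L = ?K - {\<sigma>, insert w \<sigma>}"
      using w \<sigma>(1) by (auto simp: insert_ident)
    have "elementary_collapse ?K ?L"
      unfolding elementary_collapse_def
    proof (intro bexI conjI ballI impI)
      show "?L = ?K - {\<sigma>, insert w \<sigma>}" by (rule L)
      show "\<sigma> \<subset> insert w \<sigma>" using w \<sigma>(1) by blast
      fix \<xi> assume \<xi>: "\<xi> \<in> ?K" "\<sigma> \<subset> \<xi>"
      then consider "\<xi> \<in> X" | \<zeta> where "\<zeta> \<in> X" "\<xi> = insert w \<zeta>" by blast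
      then show "\<xi> = insert w \<sigma>"
      proof cases
        case 1
        then show ?thesis using \<xi> \<sigma>(3) by blast
      next
        case 2
        then have "\<sigma> \<subseteq> \<zeta>" using \<xi> w[OF \<sigma>(1)] by blast
        then show ?thesis using 2 \<sigma>(3) by blast
      qed
    qed (use \<sigma> ne in auto)
    moreover have "collapses_to ?L {{}, {w}}"
    proof (rule remove.IH[OF \<sigma>(1)])
      show "\<And>\<xi>. \<xi> \<in> X - {\<sigma>} \<Longrightarrow> finite \<xi> \<and> w \<notin> \<xi>" using remove.prems(1) by blast
      show "{} \<in> X - {\<sigma>}" using ne remove.prems(2) by blast
      show "\<And>\<xi> \<zeta>. \<xi> \<in> X - {\<sigma>} \<Longrightarrow> \<zeta> \<subseteq> \<xi> \<Longrightarrow> \<zeta> \<in> X - {\<sigma>}" using remove.prems(3) \<sigma>(3) by blast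
    qed
    ultimately show ?thesis unfolding collapses_to_def by (rule converse_rtranclp_into_rtranclp)
  qed
qed

text \<open>After relabelling by natural numbers the complex is the cone over the simplices that
  avoid the apex \<open>f w\<close>, and no further subdivision is made.\<close>

lemma cone_collapsible:
  assumes K: "abstract_complex K" and cone: "\<And>\<sigma>. \<sigma> \<in> K \<Longrightarrow> insert w \<sigma> \<in> K"
  shows "collapsible K"
proof -
  obtain f :: "'a \<Rightarrow> nat" where f: "inj_on f (vertices K)"
    using finite_imp_inj_to_nat_seg[OF finite_vertices[OF K]] by blast
  let ?M = "(`) f ` K"
  define X where "X = {\<sigma> \<in> ?M. f w \<notin> \<sigma>}"
  have M: "abstract_complex ?M" by (rule abstract_complex_image[OF K])
  have cM: "insert (f w) \<sigma> \<in> ?M" if "\<sigma> \<in> ?M" for \<sigma>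
    using that cone by (auto simp flip: image_insert)
  have "?M = X \<union> insert (f w) ` X"
  proof (intro equalityI subsetI)
    fix \<sigma> assume \<sigma>: "\<sigma> \<in> ?M"
    then have "\<sigma> - {f w} \<in> X" using abstract_complex_subset[OF M \<sigma>] by (auto simp: X_def)
    moreover have "\<sigma> \<in> X \<or> \<sigma> = insert (f w) (\<sigma> - {f w})" using \<sigma> by (auto simp: X_def)
    ultimately show "\<sigma> \<in> X \<union> insert (f w) ` X" by blast
  qed (use cM in \<open>auto simp: X_def\<close>)
  moreover have "collapses_to (X \<union> insert (f w) ` X) {{}, {f w}}"
    by (rule cone_collapses_to_apex) (use M in \<open>auto simp: X_def abstract_complex_def\<close>)
  ultimately show ?thesis
    using relabelling_is_subdivision[OF K f] unfolding collapsible_def by metis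
qed

section \<open>Principal simplices of minimal spheres\<close>

definition simplex_link :: "'a set \<Rightarrow> 'a set set \<Rightarrow> 'a set set" where
  "simplex_link \<rho> K = {\<sigma>. \<sigma> \<inter> \<rho> = {} \<and> \<sigma> \<union> \<rho> \<in> K}"

text \<open>Links of simplices are iterated vertex links. This carries the inductive definition,
  which speaks of vertex links, over to links of arbitrary simplices.\<close>

lemma simplex_link_insert:
  assumes "abstract_complex K" "x \<notin> \<rho>"
  shows "simplex_link (insert x \<rho>) K = simplex_link \<rho> (vertex_link x K)"
proof -
  have "\<sigma> \<union> \<rho> \<in> K" if "insert x (\<sigma> \<union> \<rho>) \<in> K" for \<sigma>
    by (rule abstract_complex_subset[OF assms(1) that]) blast
  then show ?thesis using assms(2) by (auto simp: simplex_link_def vertex_link_def)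
qed

lemma simplex_link_empty: "simplex_link {} K = K"
  by (simp add: simplex_link_def)

lemma NH_manifoldD:
  assumes "NH_manifold d M"
  shows "abstract_complex M" "complex_dim M = d"
  using assms by (cases; simp)+

lemma NH_ballD:
  assumes "NH_ball d B"
  shows "abstract_complex B" "complex_dim B = d" "1 \<le> d \<Longrightarrow> NH_manifold d B \<and> collapsible B"
  using assms by (cases; simp add: combinatorial_ballD NH_manifoldD)+

lemma NH_sphereD:
  assumes "NH_sphere d k S"
  shows "abstract_complex S" "complex_dim S = d" "1 \<le> d \<Longrightarrow> NH_manifold d S"
proof -
  have "abstract_complex S \<and> complex_dim S = d \<and> (1 \<le> d \<longrightarrow> NH_manifold d S)"
    using assms
  proof cases
    case NH_sphere_minus_one
    then show ?thesis by (simp add: complex_dim_def simplex_dim_def abstract_complex_def)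
  next
    case NH_sphere_zero
    then show ?thesis by (simp add: combinatorial_sphere_0D)
  next
    case NH_sphere_pos
    then show ?thesis by (simp add: NH_manifoldD)
  qed
  then show "abstract_complex S" "complex_dim S = d" "1 \<le> d \<Longrightarrow> NH_manifold d S" by blast+
qed

lemma NH_manifold_link:
  assumes "NH_manifold d M" "1 \<le> d" "v \<in> vertices M"
  shows "(\<exists>j. NH_ball j (vertex_link v M)) \<or> (\<exists>j k. NH_sphere j k (vertex_link v M))"
  using assms by (auto elim!: NH_manifold.cases)

lemma NH_sphere_decomposition:
  assumes "NH_sphere d k S" "1 \<le> d"
  obtains B L where "top_generated B S" "NH_ball d B" "top_generated L S" "combinatorial_ball k L"
    "B \<union> L = S" "B \<inter> L = complex_boundary L"
  using assms by (auto elim!: NH_sphere.cases)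

lemma principal_disjoint_simplices:
  assumes "\<sigma> \<in> principal_simplices (Pow X \<union> Pow Y)"
  shows "\<sigma> = X \<or> \<sigma> = Y"
  using assms by (auto simp: principal_simplices_def)

text \<open>A top simplex \<open>G\<close> of \<open>L\<close> would be \<open>X\<close> or
  \<open>Y\<close>. A ridge of \<open>G\<close> still has a vertex \<open>u\<close>, and the second
  principal simplex through that ridge would put \<open>u\<close> into both sets.\<close>

lemma NH_sphere_not_disjoint_simplices:
  assumes S: "NH_sphere d k (Pow X \<union> Pow Y)" and XY: "X \<inter> Y = {}" "2 \<le> card X" "2 \<le> card Y"
  shows False
proof -
  let ?S = "Pow X \<union> Pow Y"
  have "1 \<le> d" using complex_dim_ge[OF NH_sphereD(1)[OF S], of X] NH_sphereD(2)[OF S] XY by auto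
  then obtain B L where L: "top_generated B ?S" "top_generated L ?S" "combinatorial_ball k L"
    "B \<inter> L = complex_boundary L" using NH_sphere_decomposition[OF S] by metis
  obtain G where G: "G \<in> L" "simplex_dim G = complex_dim L"
    using complex_dim_attained[OF combinatorial_ballD(1)[OF L(3)]] unfolding simplex_dim_def by blast
  note ridge = ridge_in_other_principal[OF L(1,2,4) G]
  have GXY: "G = X \<or> G = Y" by (rule principal_disjoint_simplices[OF ridge(1)])
  then obtain v u where vu: "v \<in> G" "u \<in> G" "u \<noteq> v"
    using XY by (metis card_2_iff' card_le_Suc0_iff_eq card.infinite not_numeral_le_zero numeral_2_eq_2 not_less_eq_eq)
  then obtain Q where Q: "Q \<in> principal_simplices ?S" "G - {v} \<subseteq> Q" "Q \<noteq> G"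
    using ridge(3) by blast
  have "u \<in> Q" using vu Q by blast
  with principal_disjoint_simplices[OF Q(1)] GXY Q(3) vu XY(1) show False by blast
qed

text \<open>Induction on \<open>\<rho>\<close>: the presence of \<open>X\<close> gives
  \<open>K\<close> positive dimension, so \<open>K\<close> is an NH-manifold and its vertex links
  are again NH-balls or NH-spheres. For empty \<open>\<rho>\<close>, connectedness excludes balls
  and the ridge argument excludes spheres. The cardinality bounds rule out two points, which do form
  a sphere.\<close>

lemma simplex_link_not_disjoint_simplices:
  assumes "(\<exists>j. NH_ball j K) \<or> (\<exists>j k. NH_sphere j k K)"
    and "finite \<rho>" "simplex_link \<rho> K = Pow X \<union> Pow Y"
    and "X \<inter> Y = {}" "2 \<le> card X" "2 \<le> card Y"
  shows False
  using assms(2,1,3)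
proof (induction \<rho> arbitrary: K rule: finite_induct)
  case empty
  then have K: "K = Pow X \<union> Pow Y" by (simp add: simplex_link_empty)
  from empty(1) show ?case
  proof (elim disjE exE)
    fix j assume B: "NH_ball j K"
    have "1 \<le> j" using complex_dim_ge[OF NH_ballD(1)[OF B], of X] NH_ballD(2)[OF B] K assms by auto
    then have "collapsible K" using NH_ballD(3)[OF B] by blast
    moreover have "X \<noteq> {}" "Y \<noteq> {}" using assms(5,6) by auto
    ultimately show False using disjoint_simplices_not_collapsible[OF assms(4)] K by blast
  next
    fix j k assume "NH_sphere j k K"
    then show False using NH_sphere_not_disjoint_simplices assms K by blast
  qed
next
  case (insert x \<rho>)
  have K: "abstract_complex K"
    using insert.prems(1) NH_ballD(1) NH_sphereD(1) by blast
  have Xl: "X \<inter> insert x \<rho> = {}" "X \<union> insert x \<rho> \<in> K"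
    using insert.prems(2) by (auto simp: simplex_link_def)
  have XK: "X \<in> K" "{x} \<in> K" using abstract_complex_subset[OF K Xl(2)] by auto
  then have x: "x \<in> vertices K" by (auto simp: vertices_def)
  have "1 \<le> complex_dim K" using complex_dim_ge[OF K XK(1)] assms(5) by linarith
  then have "NH_manifold (complex_dim K) K"
    using insert.prems(1) NH_ballD(2,3) NH_sphereD(2,3) by metis
  then have "(\<exists>j. NH_ball j (vertex_link x K)) \<or> (\<exists>j k. NH_sphere j k (vertex_link x K))"
    by (rule NH_manifold_link[OF _ \<open>1 \<le> complex_dim K\<close> x])
  from insert.IH[OF this] show ?case
    using simplex_link_insert[OF K insert.hyps(2)] insert.prems(2) by simp
qed

section \<open>The chain form of minimal NH-spheres\<close>

text \<open>The part generated by the principal simplices other than \<open>F\<close>. For empty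
  \<open>F\<close> it is the void family, which is not a complex, while
  \<open>chain_sphere {} W\<close> is \<open>{{}}\<close>.\<close>

definition chain_ball :: "'a set \<Rightarrow> ('a \<Rightarrow> 'a set) \<Rightarrow> 'a set set" where
  "chain_ball F W = (\<Union>v\<in>F. Pow (F - {v} \<union> W v))"

definition chain_sphere :: "'a set \<Rightarrow> ('a \<Rightarrow> 'a set) \<Rightarrow> 'a set set" where
  "chain_sphere F W = Pow F \<union> chain_ball F W"

definition chain_data :: "'a set \<Rightarrow> ('a \<Rightarrow> 'a set) \<Rightarrow> bool" where
  "chain_data F W \<longleftrightarrow> finite F \<and>
     (\<forall>v\<in>F. finite (W v) \<and> W v \<noteq> {} \<and> W v \<inter> F = {}) \<and>
     (\<forall>u\<in>F. \<forall>v\<in>F. W u \<subseteq> W v \<or> W v \<subseteq> W u)"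

text \<open>The two principal simplices are single points; one serves as \<open>F\<close> and the
  other as its apex set.\<close>

lemma minimal_0_sphere_chain:
  assumes S: "abstract_complex S" "complex_dim S = 0" "num_principal S = 2"
  shows "\<exists>F W. chain_data F W \<and> S = chain_sphere F W"
proof -
  have card: "card \<sigma> \<le> 1" if "\<sigma> \<in> S" for \<sigma> using complex_dim_ge[OF S(1) that] S(2) by linarith
  obtain \<alpha> \<beta> where ab: "principal_simplices S = {\<alpha>, \<beta>}" "\<alpha> \<noteq> \<beta>"
    using S(3) by (auto simp: num_principal_def card_2_iff)
  have mem: "\<alpha> \<in> S" "\<beta> \<in> S" using ab principal_in by blast+
  have "\<alpha> \<noteq> {}" "\<beta> \<noteq> {}" using ab mem by (auto simp: principal_simplices_def)
  then obtain a b where a: "\<alpha> = {a}" and b: "\<beta> = {b}"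
    using card[OF mem(1)] card[OF mem(2)] mem abstract_complex_finite[OF S(1)]
    by (metis One_nat_def card_1_singletonE card_gt_0_iff le_antisym Suc_leI)
  have "S = {{}, {a}, {b}}"
  proof (intro equalityI subsetI)
    fix \<sigma> assume "\<sigma> \<in> S"
    then obtain \<eta> where "\<eta> \<in> {\<alpha>, \<beta>}" "\<sigma> \<subseteq> \<eta>" using principal_above[OF S(1)] ab by metis
    then show "\<sigma> \<in> {{}, {a}, {b}}" using a b by auto
  qed (use mem a b S(1) in \<open>auto simp: abstract_complex_def\<close>)
  then have "S = chain_sphere {a} (\<lambda>_. {b})"
    by (auto simp: chain_sphere_def chain_ball_def)
  moreover have "chain_data {a} (\<lambda>_. {b})" using ab a b by (auto simp: chain_data_def)
  ultimately show ?thesis by blast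
qed

lemma minimal_NH_sphere_chain:
  assumes NH: "NH_sphere d k S" and m: "int (num_principal S) = k + 2"
  shows "\<exists>F W. chain_data F W \<and> S = chain_sphere F W"
proof (cases "1 \<le> d")
  case False
  have "S = {{}} \<or> (k = 0 \<and> combinatorial_sphere 0 S)"
    using NH False by (auto elim!: NH_sphere.cases)
  then show ?thesis
  proof (elim disjE conjE)
    assume "S = {{}}"
    then have "chain_data {} (\<lambda>_. {}) \<and> S = chain_sphere {} (\<lambda>_. {})"
      by (auto simp: chain_data_def chain_sphere_def chain_ball_def)
    then show ?thesis by blast
  next
    assume "k = 0" "combinatorial_sphere 0 S"
    then show ?thesis using minimal_0_sphere_chain[OF combinatorial_sphere_0D] m by simp
  qed
next
  case True
  have S: "abstract_complex S" using NH by (rule NH_sphereD)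
  obtain B L where dec: "top_generated B S" "NH_ball d B" "top_generated L S"
    "combinatorial_ball k L" "B \<union> L = S" "B \<inter> L = complex_boundary L"
    using NH_sphere_decomposition[OF NH True] by metis
  have L: "abstract_complex L" "complex_dim L = k" using combinatorial_ballD[OF dec(4)] by auto
  have B: "abstract_complex B" "principal_simplices B \<subseteq> principal_simplices S"
    using dec(1) by (auto simp: top_generated_def)
  obtain F where F: "F \<in> L" "simplex_dim F = complex_dim L"
    using complex_dim_attained[OF L(1)] unfolding simplex_dim_def by blast
  note ridge = ridge_in_other_principal[OF dec(1,3,6)]
  have finF: "finite F" using L F abstract_complex_finite by blast
  have cardF: "int (card F) = k + 1" using F L by (simp add: simplex_dim_def)
  obtain P where P: "\<And>v. v \<in> F \<Longrightarrow> P v \<in> principal_simplices S"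
    "\<And>v. v \<in> F \<Longrightarrow> F - {v} \<subseteq> P v" "\<And>v. v \<in> F \<Longrightarrow> P v \<noteq> F"
    using ridge(3)[OF F] by metis
  have Fp: "F \<in> principal_simplices S" by (rule ridge(1)[OF F])
  have vP: "v \<notin> P v" if "v \<in> F" for v
  proof
    assume "v \<in> P v"
    then have "F \<subseteq> P v" using P(2)[OF that] by blast
    then show False using principal_maximal[OF Fp principal_in] P that by blast
  qed
  have "inj_on P F"
  proof (rule inj_onI, rule ccontr)
    fix u v assume uv: "u \<in> F" "v \<in> F" "P u = P v" "u \<noteq> v"
    then have "v \<in> P u" using P(2)[of u] by blast
    then show False using vP[of v] uv by simp
  qed
  \<comment> \<open>\<open>F\<close> and the simplices \<open>P v\<close> are
    \<open>card F + 1 = k + 2\<close> distinct principal simplices, which is as many as there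
    are.\<close>
  then have "card (insert F (P ` F)) = card F + 1"
    using finF P(3) by (subst card_insert_disjoint) (auto simp: card_image)
  moreover have "card (principal_simplices S) = card F + 1"
    using m cardF by (simp add: num_principal_def)
  moreover have "finite (principal_simplices S)"
    using S by (simp add: abstract_complex_def principal_simplices_def)
  moreover have "insert F (P ` F) \<subseteq> principal_simplices S" using P Fp by blast
  ultimately have prin: "principal_simplices S = insert F (P ` F)"
    by (metis card_subset_eq)
  define W where "W = (\<lambda>v. P v - F)"
  have PW: "P v = F - {v} \<union> W v" if "v \<in> F" for v
    using P(2)[OF that] vP[OF that] by (auto simp: W_def)
  have finP: "finite (P v)" if "v \<in> F" for v
    using P(1)[OF that] principal_in abstract_complex_finite[OF S] by blast
  have Wne: "W v \<noteq> {}" if "v \<in> F" for v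
  proof
    assume "W v = {}"
    then have "P v \<subseteq> F" using PW[OF that] by blast
    then show False using principal_maximal[OF P(1)[OF that] principal_in[OF Fp]] P(3)[OF that] by blast
  qed
  have eq: "S = chain_sphere F W"
  proof (intro equalityI subsetI)
    fix \<sigma> assume "\<sigma> \<in> S"
    then obtain \<eta> where "\<eta> \<in> insert F (P ` F)" "\<sigma> \<subseteq> \<eta>" using principal_above[OF S] prin by metis
    then show "\<sigma> \<in> chain_sphere F W" using PW by (auto simp: chain_sphere_def chain_ball_def)
  next
    fix \<sigma> assume "\<sigma> \<in> chain_sphere F W"
    then have "\<exists>\<eta>\<in>insert F (P ` F). \<sigma> \<subseteq> \<eta>" using PW by (auto simp: chain_sphere_def chain_ball_def)
    then show "\<sigma> \<in> S" using prin principal_in abstract_complex_subset[OF S] by metis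
  qed
  \<comment> \<open>A simplex \<open>P u\<close> of \<open>L\<close> has at most
    \<open>card F\<close> vertices, so \<open>W u\<close> is a single vertex \<open>w\<close> and
    \<open>P u\<close> is a top simplex of \<open>L\<close>. The principal simplex \<open>Q\<close>
    across its ridge opposite \<open>v\<close> contains \<open>w\<close> and can only be
    \<open>P v\<close>.\<close>
  have in_L: "W u \<subseteq> W v" if uv: "u \<in> F" "v \<in> F" "u \<noteq> v" and PL: "P u \<in> L" for u v
  proof -
    have "card (P u) = card (F - {u}) + card (W u)"
      unfolding PW[OF uv(1)] by (rule card_Un_disjoint) (use finF finP[OF uv(1)] in \<open>auto simp: W_def\<close>)
    moreover have "card (F - {u}) = card F - 1" "card F > 0"
      using uv finF by (auto simp: card_gt_0_iff)
    moreover have "card (W u) > 0"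
      using Wne[OF uv(1)] finP[OF uv(1)] by (simp add: card_gt_0_iff W_def)
    moreover have "int (card (P u)) - 1 \<le> k" using complex_dim_ge[OF L(1) PL] L(2) by simp
    ultimately have "card (W u) = 1" "simplex_dim (P u) = complex_dim L"
      using cardF L(2) by (auto simp: simplex_dim_def)
    then obtain w where w: "W u = {w}" using card_1_singletonE by blast
    have "v \<in> P u" using PW uv by blast
    then obtain Q where Q: "Q \<in> principal_simplices S" "P u - {v} \<subseteq> Q" "Q \<noteq> P u"
      using ridge(3)[OF PL \<open>simplex_dim (P u) = complex_dim L\<close>] by blast
    have wF: "w \<notin> F" "w \<in> P u" using w by (auto simp: W_def)
    then have wQ: "w \<in> Q" using Q uv by blast
    then obtain x where x: "x \<in> F" "Q = P x" using Q(1) prin wF by blast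
    have "x \<notin> P u - {v}" using Q(2) vP x by blast
    then have "x = v" using x PW[OF uv(1)] Q(3) by blast
    then show ?thesis using w wQ x wF by (auto simp: W_def)
  qed
  have in_B: "W u \<subseteq> W v \<or> W v \<subseteq> W u"
    if uv: "u \<in> F" "v \<in> F" "u \<noteq> v" and PB: "P u \<in> B" "P v \<in> B" for u v
  proof (rule ccontr)
    assume "\<not> ?thesis"
    then obtain a b where a: "a \<in> W u" "a \<notin> W v" and b: "b \<in> W v" "b \<notin> W u" by blast
    let ?\<rho> = "P u \<inter> P v"
    \<comment> \<open>\<open>?\<rho>\<close> contains \<open>F - {u, v}\<close>, and a simplex
      \<open>P x\<close> misses \<open>x\<close>; so only \<open>P u\<close> and \<open>P v\<close>
      among the principal simplices of \<open>B\<close> contain \<open>?\<rho>\<close>.\<close>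
    have link: "simplex_link ?\<rho> B = Pow (P u - ?\<rho>) \<union> Pow (P v - ?\<rho>)"
    proof (intro equalityI subsetI)
      fix \<sigma> assume "\<sigma> \<in> simplex_link ?\<rho> B"
      then have \<sigma>: "\<sigma> \<inter> ?\<rho> = {}" "\<sigma> \<union> ?\<rho> \<in> B" by (auto simp: simplex_link_def)
      then obtain \<eta> where \<eta>: "\<eta> \<in> principal_simplices B" "\<sigma> \<union> ?\<rho> \<subseteq> \<eta>"
        using principal_above[OF B(1)] by blast
      moreover have "\<eta> \<noteq> F" using ridge(2)[OF F] principal_in[OF \<eta>(1)] by blast
      ultimately obtain x where x: "x \<in> F" "\<eta> = P x" using B(2) prin by blast
      have "x \<notin> ?\<rho>" using \<eta>(2) vP x by blast
      then have "x = u \<or> x = v" using x PW uv by blast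
      then show "\<sigma> \<in> Pow (P u - ?\<rho>) \<union> Pow (P v - ?\<rho>)" using x \<eta>(2) \<sigma>(1) by blast
    next
      fix \<sigma> assume "\<sigma> \<in> Pow (P u - ?\<rho>) \<union> Pow (P v - ?\<rho>)"
      then have "\<sigma> \<inter> ?\<rho> = {}" "\<sigma> \<union> ?\<rho> \<subseteq> P u \<or> \<sigma> \<union> ?\<rho> \<subseteq> P v" by blast+
      then show "\<sigma> \<in> simplex_link ?\<rho> B"
        using PB abstract_complex_subset[OF B(1)] by (auto simp: simplex_link_def)
    qed
    have two: "2 \<le> card X" if "finite X" "x \<in> X" "y \<in> X" "x \<noteq> y" for X and x y :: 'a
      using card_mono[of X "{x, y}"] that by auto
    \<comment> \<open>Incomparability supplies the second vertex on each side: \<open>v\<close> and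
      \<open>a\<close> on one, \<open>u\<close> and \<open>b\<close> on the other.\<close>
    have Pu: "v \<in> P u - ?\<rho>" "a \<in> P u - ?\<rho>" "v \<noteq> a" and Pv: "u \<in> P v - ?\<rho>" "b \<in> P v - ?\<rho>" "u \<noteq> b"
      using PW uv a b vP by (auto simp: W_def)
    show False
      by (rule simplex_link_not_disjoint_simplices[OF _ _ link])
        (use dec(2) finP uv two[OF _ Pu] two[OF _ Pv] in auto)
  qed
  have "W u \<subseteq> W v \<or> W v \<subseteq> W u" if uv: "u \<in> F" "v \<in> F" for u v
  proof (cases "u = v")
    case False
    \<comment> \<open>If one of the two simplices lies in \<open>L\<close>, its apex set is
      contained in the other one; otherwise both lie in \<open>B\<close>.\<close>
    have "P u \<in> B \<or> P u \<in> L" "P v \<in> B \<or> P v \<in> L" using P(1) uv principal_in dec(5) by blast+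
    then show ?thesis using in_L[OF uv False] in_L[OF uv(2,1)] in_B[OF uv False] False by blast
  qed simp
  then have "chain_data F W" using finF finP Wne by (auto simp: chain_data_def W_def)
  with eq show ?thesis by blast
qed

section \<open>Chain spheres are minimal\<close>

lemma abstract_complex_chain_ball:
  assumes "chain_data F W" "F \<noteq> {}"
  shows "abstract_complex (chain_ball F W)"
proof -
  have "finite (F - {v} \<union> W v)" if "v \<in> F" for v using assms that by (auto simp: chain_data_def)
  moreover have "finite F" using assms by (simp add: chain_data_def)
  ultimately show ?thesis
    using assms(2) unfolding abstract_complex_def chain_ball_def
    by (auto intro: finite_subset)
qed

lemma abstract_complex_chain_sphere:
  assumes "chain_data F W"
  shows "abstract_complex (chain_sphere F W)"
proof (cases "F = {}")
  case True
  then show ?thesis by (simp add: chain_sphere_def chain_ball_def abstract_complex_def)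
next
  case False
  then have "abstract_complex (Pow F)" "abstract_complex (chain_ball F W)"
    using assms abstract_complex_chain_ball abstract_complex_Pow by (auto simp: chain_data_def)
  then show ?thesis unfolding chain_sphere_def abstract_complex_def by blast
qed

lemma vertices_chain_sphere: "vertices (chain_sphere F W) = F \<union> (\<Union>v\<in>F. W v)"
  unfolding vertices_def chain_sphere_def chain_ball_def by blast

lemma complex_dim_link_le:
  assumes K: "abstract_complex K" and "abstract_complex (vertex_link v K)"
  shows "complex_dim (vertex_link v K) \<le> complex_dim K - 1"
proof -
  obtain \<sigma> where \<sigma>: "\<sigma> \<in> vertex_link v K" "int (card \<sigma>) - 1 = complex_dim (vertex_link v K)"
    using complex_dim_attained[OF assms(2)] by blast
  then have *: "v \<notin> \<sigma>" "insert v \<sigma> \<in> K" "\<sigma> \<in> K" by (auto simp: vertex_link_def)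
  have "card (insert v \<sigma>) = card \<sigma> + 1" using * abstract_complex_finite[OF K] by simp
  then show ?thesis using complex_dim_ge[OF K *(2)] \<sigma>(2) by simp
qed

lemma principal_chain_ball:
  assumes "\<sigma> \<in> principal_simplices (chain_ball F W)"
  obtains v where "v \<in> F" "\<sigma> = F - {v} \<union> W v"
proof -
  have "\<sigma> \<in> chain_ball F W" using assms by (rule principal_in)
  then obtain v where v: "v \<in> F" "\<sigma> \<subseteq> F - {v} \<union> W v" by (auto simp: chain_ball_def)
  moreover from v have "F - {v} \<union> W v \<in> chain_ball F W" unfolding chain_ball_def by blast
  ultimately show thesis using that principal_maximal[OF assms] by blast
qed

text \<open>\<open>F - {v} \<union> W v\<close> is not inside \<open>F\<close> because
  \<open>W v\<close> is nonempty and disjoint from \<open>F\<close>, and \<open>v\<close> is the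
  only vertex of \<open>F\<close> that it misses. Hence none of the listed simplices contains
  another.\<close>

lemma principal_chain_sphere:
  assumes "chain_data F W"
  shows "principal_simplices (chain_sphere F W) = insert F ((\<lambda>v. F - {v} \<union> W v) ` F)"
proof -
  have W: "W v \<noteq> {}" "W v \<inter> F = {}" if "v \<in> F" for v using assms that by (auto simp: chain_data_def)
  have mem: "F \<in> chain_sphere F W" "\<And>v. v \<in> F \<Longrightarrow> F - {v} \<union> W v \<in> chain_sphere F W"
    unfolding chain_sphere_def chain_ball_def by blast+
  have cases: "\<sigma> \<subseteq> F \<or> (\<exists>v\<in>F. \<sigma> \<subseteq> F - {v} \<union> W v)" if "\<sigma> \<in> chain_sphere F W" for \<sigma>
    using that unfolding chain_sphere_def chain_ball_def by blast
  show ?thesis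
  proof (intro equalityI subsetI)
    fix \<sigma> assume \<sigma>: "\<sigma> \<in> principal_simplices (chain_sphere F W)"
    from cases[OF principal_in[OF \<sigma>]] show "\<sigma> \<in> insert F ((\<lambda>v. F - {v} \<union> W v) ` F)"
      using principal_maximal[OF \<sigma>] mem by blast
  next
    fix \<sigma> assume \<sigma>: "\<sigma> \<in> insert F ((\<lambda>v. F - {v} \<union> W v) ` F)"
    have "\<sigma> = \<rho>" if \<rho>: "\<rho> \<in> chain_sphere F W" "\<sigma> \<subseteq> \<rho>" for \<rho>
    proof (cases "\<sigma> = F")
      case True
      then show ?thesis using cases[OF \<rho>(1)] \<rho>(2) W by blast
    next
      case False
      then obtain u where u: "u \<in> F" "\<sigma> = F - {u} \<union> W u" using \<sigma> by blast
      have "\<not> \<rho> \<subseteq> F" using u W[OF u(1)] \<rho>(2) by blast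
      then obtain v where v: "v \<in> F" "\<rho> \<subseteq> F - {v} \<union> W v" using cases[OF \<rho>(1)] by blast
      then have "u = v" using u \<rho>(2) W(2)[OF v(1)] by blast
      then show ?thesis using u v \<rho>(2) by blast
    qed
    then show "\<sigma> \<in> principal_simplices (chain_sphere F W)"
      using mem \<sigma> unfolding principal_simplices_def by blast
  qed
qed

lemma num_principal_chain_sphere:
  assumes "chain_data F W"
  shows "num_principal (chain_sphere F W) = card F + 1"
proof -
  have W: "W v \<inter> F = {}" if "v \<in> F" for v using assms that by (auto simp: chain_data_def)
  have "inj_on (\<lambda>v. F - {v} \<union> W v) F" using W by (intro inj_onI) blast
  moreover have "F \<notin> (\<lambda>v. F - {v} \<union> W v) ` F" using W by blast
  moreover have "finite F" using assms by (simp add: chain_data_def)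
  ultimately show ?thesis
    unfolding num_principal_def principal_chain_sphere[OF assms] by (simp add: card_image)
qed

section \<open>Vertex links of chain balls and chain spheres\<close>

text \<open>The generating simplex indexed by \<open>v\<close> is the only one that misses
  \<open>v\<close>, so it drops out and the others lose \<open>v\<close>.\<close>

lemma link_chain_ball_base:
  assumes "chain_data F W" "v \<in> F"
  shows "vertex_link v (chain_ball F W) = chain_ball (F - {v}) W"
proof -
  have W: "W u \<inter> F = {}" if "u \<in> F" for u using assms that by (auto simp: chain_data_def)
  show ?thesis
  proof (intro equalityI subsetI)
    fix \<sigma> assume "\<sigma> \<in> vertex_link v (chain_ball F W)"
    then obtain u where "v \<notin> \<sigma>" "u \<in> F" "insert v \<sigma> \<subseteq> F - {u} \<union> W u"
      unfolding vertex_link_def chain_ball_def by blast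
    moreover from this have "u \<noteq> v" using W assms(2) by blast
    ultimately show "\<sigma> \<in> chain_ball (F - {v}) W" unfolding chain_ball_def by blast
  next
    fix \<sigma> assume "\<sigma> \<in> chain_ball (F - {v}) W"
    then obtain u where u: "u \<in> F" "u \<noteq> v" "\<sigma> \<subseteq> F - {v} - {u} \<union> W u" unfolding chain_ball_def by blast
    then have "v \<notin> \<sigma>" "\<sigma> \<subseteq> F - {u} \<union> W u" "insert v \<sigma> \<subseteq> F - {u} \<union> W u"
      using W assms(2) by blast+
    then show "\<sigma> \<in> vertex_link v (chain_ball F W)"
      using u unfolding vertex_link_def chain_ball_def by blast
  qed
qed

lemma link_chain_sphere_base:
  assumes "chain_data F W" "v \<in> F"
  shows "vertex_link v (chain_sphere F W) = chain_sphere (F - {v}) W"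
proof -
  have "vertex_link v (chain_sphere F W) = Pow (F - {v}) \<union> vertex_link v (chain_ball F W)"
  proof (intro equalityI subsetI)
    fix \<sigma> assume "\<sigma> \<in> vertex_link v (chain_sphere F W)"
    then have "v \<notin> \<sigma>" "insert v \<sigma> \<subseteq> F \<or> insert v \<sigma> \<in> chain_ball F W"
      unfolding vertex_link_def chain_sphere_def by blast+
    moreover have "\<sigma> \<in> chain_ball F W" if "insert v \<sigma> \<in> chain_ball F W"
      using that unfolding chain_ball_def by blast
    ultimately show "\<sigma> \<in> Pow (F - {v}) \<union> vertex_link v (chain_ball F W)"
      unfolding vertex_link_def by blast
  qed (use assms(2) in \<open>auto simp: vertex_link_def chain_sphere_def\<close>)
  then show ?thesis using link_chain_ball_base[OF assms] by (simp add: chain_sphere_def)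
qed

lemma link_chain_apex:
  assumes "chain_data F W" "w \<notin> F"
  shows "vertex_link w (chain_ball F W) = (\<Union>v\<in>{v\<in>F. w \<in> W v}. Pow (F - {v} \<union> (W v - {w})))"
    and "vertex_link w (chain_sphere F W) = vertex_link w (chain_ball F W)"
proof -
  show ball: "vertex_link w (chain_ball F W) = (\<Union>v\<in>{v\<in>F. w \<in> W v}. Pow (F - {v} \<union> (W v - {w})))"
  proof (intro equalityI subsetI)
    fix \<sigma> assume "\<sigma> \<in> vertex_link w (chain_ball F W)"
    then obtain v where "w \<notin> \<sigma>" "v \<in> F" "insert w \<sigma> \<subseteq> F - {v} \<union> W v"
      unfolding vertex_link_def chain_ball_def by blast
    then show "\<sigma> \<in> (\<Union>v\<in>{v\<in>F. w \<in> W v}. Pow (F - {v} \<union> (W v - {w})))" using assms(2) by blast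
  next
    fix \<sigma> assume "\<sigma> \<in> (\<Union>v\<in>{v\<in>F. w \<in> W v}. Pow (F - {v} \<union> (W v - {w})))"
    then obtain v where v: "v \<in> F" "w \<in> W v" "\<sigma> \<subseteq> F - {v} \<union> (W v - {w})" by blast
    then have "w \<notin> \<sigma>" "\<sigma> \<subseteq> F - {v} \<union> W v" "insert w \<sigma> \<subseteq> F - {v} \<union> W v" using assms(2) by blast+
    then show "\<sigma> \<in> vertex_link w (chain_ball F W)"
      using v(1) unfolding vertex_link_def chain_ball_def by blast
  qed
  have "\<sigma> \<in> chain_ball F W" if "insert w \<sigma> \<in> chain_ball F W" for \<sigma>
    using that unfolding chain_ball_def by blast
  then show "vertex_link w (chain_sphere F W) = vertex_link w (chain_ball F W)"
    using assms(2) unfolding vertex_link_def chain_sphere_def by blast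
qed

lemma chain_data_subset: "chain_data F W \<Longrightarrow> G \<subseteq> F \<Longrightarrow> chain_data G W"
  unfolding chain_data_def by (meson finite_subset subsetD disjoint_iff)

text \<open>
  In the sphere case, removing \<open>w\<close> leaves some \<open>W v = {w}\<close> empty; then \<open>F - {v}\<close> becomes a
  principal simplex and the vertex \<open>v\<close> takes over the role of \<open>w\<close>.
\<close>

lemma link_chain_apex_cases:
  assumes data: "chain_data F W" and w: "w \<in> W u" "u \<in> F"
  obtains G U where "chain_data G U" "G \<noteq> {}" "vertex_link w (chain_ball F W) = chain_ball G U"
      "G \<union> (\<Union>v\<in>G. U v) \<subseteq> F \<union> (\<Union>v\<in>F. W v) - {w}"
  | G U where "chain_data G U" "vertex_link w (chain_ball F W) = chain_sphere G U"
      "G \<union> (\<Union>v\<in>G. U v) \<subseteq> F \<union> (\<Union>v\<in>F. W v) - {w}"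
proof -
  have W: "finite (W v)" "W v \<noteq> {}" "W v \<inter> F = {}" if "v \<in> F" for v
    using data that by (auto simp: chain_data_def)
  have chain: "W u \<subseteq> W v \<or> W v \<subseteq> W u" if "u \<in> F" "v \<in> F" for u v
    using data that by (auto simp: chain_data_def)
  have finF: "finite F" using data by (simp add: chain_data_def)
  have wF: "w \<notin> F" using W(3) w by blast
  define I where "I = {v\<in>F. w \<in> W v}"
  have link: "vertex_link w (chain_ball F W) = (\<Union>v\<in>I. Pow (F - {v} \<union> (W v - {w})))"
    unfolding I_def by (rule link_chain_apex(1)[OF data wF])
  show thesis
  proof (cases "I = F \<and> (\<exists>v\<in>F. W v = {w})")
    case False
    \<comment> \<open>Vertices of \<open>F\<close> outside \<open>I\<close> lie in every generating
      simplex of the link, so they move from the base into all apex sets. They also keep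
      \<open>U v\<close> nonempty when \<open>W v = {w}\<close> and \<open>I\<close> is not all of
      \<open>F\<close>.\<close>
    define U where "U = (\<lambda>v. (F - I) \<union> (W v - {w}))"
    have "U v \<noteq> {}" if "v \<in> I" for v
    proof (cases "I = F")
      case True
      then have "W v \<noteq> {w}" using False that by blast
      then show ?thesis using that unfolding U_def I_def by blast
    qed (auto simp: U_def I_def)
    moreover have "finite (U v)" "U v \<inter> I = {}" if "v \<in> I" for v
      using that W finF by (auto simp: U_def I_def)
    moreover have "U x \<subseteq> U y \<or> U y \<subseteq> U x" if "x \<in> I" "y \<in> I" for x y
      using that chain[of x y] unfolding U_def I_def by blast
    moreover have "finite I" using finF by (simp add: I_def)
    ultimately have "chain_data I U" by (simp add: chain_data_def)
    moreover have "I \<noteq> {}" using w by (auto simp: I_def)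
    moreover have "vertex_link w (chain_ball F W) = chain_ball I U"
    proof -
      have "F - {v} \<union> (W v - {w}) = I - {v} \<union> U v" if "v \<in> I" for v
        using that unfolding U_def I_def by blast
      then show ?thesis unfolding link unfolding chain_ball_def by simp
    qed
    moreover have "I \<union> (\<Union>v\<in>I. U v) \<subseteq> F \<union> (\<Union>v\<in>F. W v) - {w}"
      using wF unfolding U_def I_def by blast
    ultimately show thesis by (rule that(1))
  next
    case True
    then obtain x where x: "x \<in> F" "W x = {w}" and IF: "I = F" by blast
    define U where "U = (\<lambda>v. insert x (W v - {w}))"
    have "chain_data (F - {x}) U"
      unfolding chain_data_def
    proof (intro conjI ballI)
      show "finite (F - {x})" using finF by simp
      fix u assume u: "u \<in> F - {x}"
      show "finite (U u)" "U u \<noteq> {}" "U u \<inter> (F - {x}) = {}" using u W unfolding U_def by auto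
      fix v assume "v \<in> F - {x}"
      then show "U u \<subseteq> U v \<or> U v \<subseteq> U u" using u chain[of u v] unfolding U_def by blast
    qed
    moreover have "vertex_link w (chain_ball F W) = chain_sphere (F - {x}) U"
    proof -
      have "F - {v} \<union> (W v - {w}) = F - {x} - {v} \<union> U v" if "v \<in> F - {x}" for v
        using that x unfolding U_def by blast
      then have "(\<Union>v\<in>F - {x}. Pow (F - {v} \<union> (W v - {w}))) = chain_ball (F - {x}) U"
        unfolding chain_ball_def by simp
      moreover have "F = insert x (F - {x})" using x by blast
      then have "(\<Union>v\<in>F. Pow (F - {v} \<union> (W v - {w})))
          = Pow (F - {x} \<union> (W x - {w})) \<union> (\<Union>v\<in>F - {x}. Pow (F - {v} \<union> (W v - {w})))"
        by (metis (no_types, lifting) UN_insert)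
      ultimately show ?thesis unfolding link IF chain_sphere_def using x by simp
    qed
    moreover have "F - {x} \<union> (\<Union>v\<in>F - {x}. U v) \<subseteq> F \<union> (\<Union>v\<in>F. W v) - {w}"
      using wF x unfolding U_def by blast
    ultimately show thesis by (rule that(2))
  qed
qed

section \<open>Chain complexes as NH-balls and NH-spheres\<close>

lemma finite_chain_has_min:
  assumes "finite F" "F \<noteq> {}" "\<forall>u\<in>F. \<forall>v\<in>F. W u \<subseteq> W v \<or> W v \<subseteq> W u"
  shows "\<exists>m\<in>F. \<forall>v\<in>F. W m \<subseteq> W v" "\<exists>m\<in>F. \<forall>v\<in>F. W v \<subseteq> W m"
proof -
  have fin: "finite (W ` F)" and ne: "W ` F \<noteq> {}" using assms by auto
  from finite_has_minimal[OF this] obtain m where "m \<in> F" "\<forall>b\<in>W ` F. b \<subseteq> W m \<longrightarrow> W m = b" by auto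
  then show "\<exists>m\<in>F. \<forall>v\<in>F. W m \<subseteq> W v"
    using assms(3) by (intro bexI[of _ m] ballI) (metis imageI order_refl)+
  from finite_has_maximal[OF fin ne] obtain n where "n \<in> F" "\<forall>b\<in>W ` F. W n \<subseteq> b \<longrightarrow> W n = b" by auto
  then show "\<exists>m\<in>F. \<forall>v\<in>F. W v \<subseteq> W m"
    using assms(3) by (intro bexI[of _ n] ballI) (metis imageI order_refl)+
qed

text \<open>A vertex of the smallest apex set lies in every generating simplex, so the complex is a
  cone.\<close>

lemma collapsible_chain_ball:
  assumes "chain_data F W" "F \<noteq> {}"
  shows "collapsible (chain_ball F W)"
proof -
  obtain m where m: "m \<in> F" "\<forall>v\<in>F. W m \<subseteq> W v"
    using finite_chain_has_min(1)[of F W] assms by (auto simp: chain_data_def)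
  moreover have "W m \<noteq> {}" using m assms by (simp add: chain_data_def)
  ultimately obtain w where "\<forall>v\<in>F. w \<in> W v" by blast
  then have "insert w \<sigma> \<in> chain_ball F W" if "\<sigma> \<in> chain_ball F W" for \<sigma>
    using that unfolding chain_ball_def by blast
  then show ?thesis by (rule cone_collapsible[OF abstract_complex_chain_ball[OF assms]])
qed

lemma card_chain_simplex:
  assumes "chain_data F W" "v \<in> F"
  shows "card (F - {v} \<union> W v) + 1 = card F + card (W v)" "1 \<le> card (W v)"
proof -
  have W: "finite (W v)" "W v \<noteq> {}" "W v \<inter> F = {}" and F: "finite F"
    using assms by (auto simp: chain_data_def)
  have "card (F - {v} \<union> W v) = card (F - {v}) + card (W v)"
    by (rule card_Un_disjoint) (use W F in auto)
  moreover have "card (F - {v}) + 1 = card F"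
    using card_Suc_Diff1[OF F assms(2)] by simp
  ultimately show "card (F - {v} \<union> W v) + 1 = card F + card (W v)" by simp
  show "1 \<le> card (W v)" using W by (simp add: Suc_le_eq card_gt_0_iff)
qed

text \<open>Replacing \<open>v\<close> by the nonempty set \<open>W v\<close> does not decrease the
  size, so \<open>F\<close> has at most as many vertices as a simplex of the ball.\<close>

lemma complex_dim_chain_sphere:
  assumes "chain_data F W" "F \<noteq> {}"
  shows "complex_dim (chain_sphere F W) = complex_dim (chain_ball F W)"
proof (rule antisym)
  note cs = abstract_complex_chain_sphere[OF assms(1)] abstract_complex_chain_ball[OF assms]
  obtain v where v: "v \<in> F" using assms by blast
  have "finite F" using assms by (simp add: chain_data_def)
  then have "\<exists>\<rho>\<in>chain_ball F W. card \<sigma> \<le> card \<rho>" if "\<sigma> \<in> chain_sphere F W" for \<sigma>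
  proof (cases "\<sigma> \<in> chain_ball F W")
    case False
    then have "card \<sigma> \<le> card F"
      using that \<open>finite F\<close> by (auto simp: chain_sphere_def intro: card_mono)
    moreover have "card F \<le> card (F - {v} \<union> W v)" using card_chain_simplex[OF assms(1) v] by linarith
    moreover have "F - {v} \<union> W v \<in> chain_ball F W" using v unfolding chain_ball_def by blast
    ultimately show ?thesis using le_trans by blast
  qed blast
  then show "complex_dim (chain_sphere F W) \<le> complex_dim (chain_ball F W)"
    by (rule complex_dim_mono[OF cs])
  show "complex_dim (chain_ball F W) \<le> complex_dim (chain_sphere F W)"
    by (rule complex_dim_mono[OF cs(2,1)]) (auto simp: chain_sphere_def)
qed

text \<open>Isolates the base cases, where NH-balls and NH-spheres are single points and pairs of
  points. A generating simplex with at most one vertex forces \<open>F\<close> and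
  \<open>W v\<close>, both nonempty, to be singletons.\<close>

lemma chain_ball_dim_0:
  assumes data: "chain_data F W" "F \<noteq> {}" and "complex_dim (chain_ball F W) < 1"
  obtains v w where "F = {v}" "W v = {w}" "v \<noteq> w"
proof -
  obtain v where v: "v \<in> F" using data by blast
  have "F - {v} \<union> W v \<in> chain_ball F W" using v unfolding chain_ball_def by blast
  from complex_dim_ge[OF abstract_complex_chain_ball[OF data] this] assms(3)
  have "card (F - {v} \<union> W v) \<le> 1" by linarith
  moreover have "card F > 0" using v data by (auto simp: card_gt_0_iff chain_data_def)
  ultimately have "card F = 1" "card (W v) = 1" using card_chain_simplex[OF data(1) v] by linarith+
  then obtain w where "F = {v}" "W v = {w}" using v by (metis card_1_singletonE singletonD)
  moreover from this have "v \<noteq> w" using data by (auto simp: chain_data_def)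
  ultimately show thesis by (rule that)
qed

text \<open>Simultaneous induction on the number of vertices, because the link of an apex vertex can
  have either shape. Links of vertices of \<open>F\<close> keep their shape, with
  \<open>F - {v}\<close> in place of \<open>F\<close>.\<close>

lemma NH_chain_sphere_ball:
  assumes "chain_data F W"
  shows "NH_sphere (complex_dim (chain_sphere F W)) (int (card F) - 1) (chain_sphere F W)"
    and "F \<noteq> {} \<Longrightarrow> NH_ball (complex_dim (chain_ball F W)) (chain_ball F W)"
proof -
  have "NH_sphere (complex_dim (chain_sphere F W)) (int (card F) - 1) (chain_sphere F W) \<and>
    (F \<noteq> {} \<longrightarrow> NH_ball (complex_dim (chain_ball F W)) (chain_ball F W))"
    using assms
  proof (induction "card (F \<union> (\<Union>v\<in>F. W v))" arbitrary: F W rule: less_induct)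
    case less
    note data = less.prems
    have finV: "finite (F \<union> (\<Union>v\<in>F. W v))" using data by (auto simp: chain_data_def)
    have smaller: "card (G \<union> (\<Union>v\<in>G. U v)) < card (F \<union> (\<Union>v\<in>F. W v))"
      if "G \<union> (\<Union>v\<in>G. U v) \<subseteq> F \<union> (\<Union>v\<in>F. W v) - {x}" "x \<in> F \<union> (\<Union>v\<in>F. W v)"
      for x :: 'a and G U
      by (rule psubset_card_mono[OF finV]) (use that in blast)
    have IHs: "\<exists>j k. NH_sphere j k (chain_sphere G U)"
      and IHb: "G \<noteq> {} \<Longrightarrow> \<exists>j. NH_ball j (chain_ball G U)"
      if "G \<union> (\<Union>v\<in>G. U v) \<subseteq> F \<union> (\<Union>v\<in>F. W v) - {x}" "x \<in> F \<union> (\<Union>v\<in>F. W v)" "chain_data G U"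
      for x G U
      using less.hyps[OF smaller[OF that(1,2)] that(3)] by blast+
    have apex: "(\<exists>j. NH_ball j (vertex_link w (chain_ball F W))) \<or>
        (\<exists>j k. NH_sphere j k (vertex_link w (chain_ball F W)))"
      if w: "w \<in> W u" "u \<in> F" for w u
    proof -
      have "w \<in> F \<union> (\<Union>v\<in>F. W v)" using w by blast
      note IHs = IHs[OF _ this] and IHb = IHb[OF _ this]
      show ?thesis
      proof (rule link_chain_apex_cases[OF data w])
        fix G U assume GU: "chain_data G U" "G \<noteq> {}"
          and "vertex_link w (chain_ball F W) = chain_ball G U"
          and "G \<union> (\<Union>v\<in>G. U v) \<subseteq> F \<union> (\<Union>v\<in>F. W v) - {w}"
        then show ?thesis using IHb[OF _ GU] by simp
      next
        fix G U assume GU: "chain_data G U"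
          and "vertex_link w (chain_ball F W) = chain_sphere G U"
          and "G \<union> (\<Union>v\<in>G. U v) \<subseteq> F \<union> (\<Union>v\<in>F. W v) - {w}"
        then show ?thesis using IHs[OF _ GU] by simp
      qed
    qed
    \<comment> \<open>The apex sets are disjoint from \<open>F\<close>, so passing to
      \<open>F - {v}\<close> really loses the vertex \<open>v\<close>.\<close>
    have base: "F - {v} \<union> (\<Union>u\<in>F - {v}. W u) \<subseteq> F \<union> (\<Union>u\<in>F. W u) - {v}" "chain_data (F - {v}) W"
      if "v \<in> F" for v
      using data that chain_data_subset[OF data, of "F - {v}"] by (auto simp: chain_data_def)
    have linkS: "(\<exists>j. NH_ball j (vertex_link v (chain_sphere F W))) \<or>
        (\<exists>j k. NH_sphere j k (vertex_link v (chain_sphere F W)))"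
      if v: "v \<in> vertices (chain_sphere F W)" for v
    proof (cases "v \<in> F")
      case True
      then show ?thesis
        using IHs[OF base(1)[OF True] _ base(2)[OF True]] link_chain_sphere_base[OF data True] by simp
    next
      case False
      then obtain u where "u \<in> F" "v \<in> W u" using v by (auto simp: vertices_chain_sphere)
      then show ?thesis using apex link_chain_apex(2)[OF data False] by simp
    qed
    have linkB: "(\<exists>j. NH_ball j (vertex_link v (chain_ball F W))) \<or>
        (\<exists>j k. NH_sphere j k (vertex_link v (chain_ball F W)))"
      if v: "v \<in> vertices (chain_ball F W)" for v
    proof (cases "v \<in> F")
      case True
      \<comment> \<open>If \<open>v\<close> were the only element of \<open>F\<close>, the ball
        would be the simplex \<open>W v\<close>, of which \<open>v\<close> is not a vertex.\<close>
      have "F - {v} \<noteq> {}"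
      proof
        assume "F - {v} = {}"
        then have "F = {v}" using True by blast
        then have "v \<in> W v" using v by (auto simp: vertices_def chain_ball_def)
        then show False using data True by (auto simp: chain_data_def)
      qed
      then show ?thesis
        using IHb[OF base(1)[OF True] _ base(2)[OF True]] link_chain_ball_base[OF data True] True by simp
    next
      case False
      then obtain u where "u \<in> F" "v \<in> W u" using v by (auto simp: vertices_def chain_ball_def)
      then show ?thesis using apex by blast
    qed
    \<comment> \<open>The dimensions of the links are known only to exist; the bounds demanded of an
      NH-manifold follow because a link simplex can be enlarged by \<open>v\<close>.\<close>
    have manifold: "NH_manifold (complex_dim M) M"
      if M: "abstract_complex M" "1 \<le> complex_dim M"
        and link: "\<And>v. v \<in> vertices M \<Longrightarrow> (\<exists>j. NH_ball j (vertex_link v M)) \<or>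
          (\<exists>j k. NH_sphere j k (vertex_link v M))" for M :: "'a set set"
    proof (rule NH_manifold_pos[OF M(2,1) refl], intro ballI)
      fix v assume "v \<in> vertices M"
      from link[OF this] show "(\<exists>j. 0 \<le> j \<and> j \<le> complex_dim M - 1 \<and> NH_ball j (vertex_link v M)) \<or>
        (\<exists>j k. -1 \<le> j \<and> j \<le> complex_dim M - 1 \<and> NH_sphere j k (vertex_link v M))"
      proof (elim disjE exE)
        fix j assume B: "NH_ball j (vertex_link v M)"
        then have "0 \<le> j" by cases auto
        moreover have "j \<le> complex_dim M - 1"
          using complex_dim_link_le[OF M(1) NH_ballD(1)[OF B]] NH_ballD(2)[OF B] by simp
        ultimately show ?thesis using B by blast
      next
        fix j k assume S: "NH_sphere j k (vertex_link v M)"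
        then have "-1 \<le> j" by cases auto
        moreover have "j \<le> complex_dim M - 1"
          using complex_dim_link_le[OF M(1) NH_sphereD(1)[OF S]] NH_sphereD(2)[OF S] by simp
        ultimately show ?thesis using S by blast
      qed
    qed
    have ball: "NH_ball (complex_dim (chain_ball F W)) (chain_ball F W)" if ne: "F \<noteq> {}"
    proof (cases "1 \<le> complex_dim (chain_ball F W)")
      case True
      show ?thesis
        using NH_ball_pos[OF True manifold[OF abstract_complex_chain_ball[OF data ne] True linkB]
            collapsible_chain_ball[OF data ne]] by blast
    next
      case False
      then obtain v w where "F = {v}" "W v = {w}" using chain_ball_dim_0[OF data ne] by (metis not_le)
      then have eq: "chain_ball F W = Pow {w}" by (simp add: chain_ball_def)
      have "NH_ball 0 (Pow {w})" using combinatorial_ball_Pow[of "{w}"] by (intro NH_ball_zero) simp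
      then show ?thesis by (simp add: eq complex_dim_Pow)
    qed
    have "NH_sphere (complex_dim (chain_sphere F W)) (int (card F) - 1) (chain_sphere F W)"
    proof (cases "F = {}")
      case True
      then have "chain_sphere F W = {{}}" by (simp add: chain_sphere_def chain_ball_def)
      then show ?thesis using True NH_sphere_minus_one by (simp add: complex_dim_def simplex_dim_def)
    next
      case ne: False
      note dim = complex_dim_chain_sphere[OF data ne]
      have finF: "finite F" using data by (simp add: chain_data_def)
      show ?thesis
      proof (cases "1 \<le> complex_dim (chain_ball F W)")
        case True
        \<comment> \<open>The decomposition takes the chain ball as \<open>B\<close> and the single
          simplex \<open>F\<close> as \<open>L\<close>; they meet exactly in the proper faces of
          \<open>F\<close>.\<close>
        have "chain_ball F W \<inter> Pow F = {\<sigma>. \<sigma> \<subset> F}"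
        proof (intro equalityI subsetI)
          fix \<sigma> assume "\<sigma> \<in> chain_ball F W \<inter> Pow F"
          then obtain v where "v \<in> F" "\<sigma> \<subseteq> F - {v} \<union> W v" "\<sigma> \<subseteq> F" unfolding chain_ball_def by blast
          moreover from this have "W v \<inter> F = {}" using data by (simp add: chain_data_def)
          ultimately show "\<sigma> \<in> {\<sigma>. \<sigma> \<subset> F}" by blast
        next
          fix \<sigma> assume "\<sigma> \<in> {\<sigma>. \<sigma> \<subset> F}"
          then show "\<sigma> \<in> chain_ball F W \<inter> Pow F" unfolding chain_ball_def by blast
        qed
        then have inter: "chain_ball F W \<inter> Pow F = complex_boundary (Pow F)"
          by (simp add: complex_boundary_Pow[OF finF ne])
        have "principal_simplices (chain_ball F W) \<subseteq> principal_simplices (chain_sphere F W)"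
          unfolding principal_chain_sphere[OF data] by (blast elim: principal_chain_ball)
        then have tgB: "top_generated (chain_ball F W) (chain_sphere F W)"
          using abstract_complex_chain_ball[OF data ne]
          by (simp add: top_generated_def chain_sphere_def)
        have "principal_simplices (Pow F) = {F}" by (auto simp: principal_simplices_def)
        then have tgL: "top_generated (Pow F) (chain_sphere F W)"
          using abstract_complex_Pow[OF finF]
          by (simp add: top_generated_def principal_chain_sphere[OF data])
            (simp add: chain_sphere_def)
        have man: "NH_manifold (complex_dim (chain_ball F W)) (chain_sphere F W)"
          using manifold[OF abstract_complex_chain_sphere[OF data] _ linkS] True dim by simp
        show ?thesis unfolding dim
          by (rule NH_sphere_pos[OF True man tgB ball[OF ne] tgL combinatorial_ball_Pow[OF finF ne]
                _ inter]) (auto simp: chain_sphere_def)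
      next
        case False
        then obtain v w where vw: "F = {v}" "W v = {w}" "v \<noteq> w"
          using chain_ball_dim_0[OF data ne] by (metis not_le)
        then have eq: "chain_sphere F W = {{}, {v}, {w}}"
          by (auto simp: chain_sphere_def chain_ball_def)
        have "combinatorial_sphere 0 {{}, {v}, {w}}" by (rule combinatorial_sphere_two_points[OF vw(3)])
        then show ?thesis
          unfolding eq combinatorial_sphere_0D(2)[OF \<open>combinatorial_sphere 0 {{}, {v}, {w}}\<close>]
          using NH_sphere_zero vw(1) by simp
      qed
    qed
    then show ?case using ball by blast
  qed
  then show "NH_sphere (complex_dim (chain_sphere F W)) (int (card F) - 1) (chain_sphere F W)"
    "F \<noteq> {} \<Longrightarrow> NH_ball (complex_dim (chain_ball F W)) (chain_ball F W)" by blast+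
qed

theorem minimal_NH_sphere_iff_chain_sphere:
  "minimal_NH_sphere S \<longleftrightarrow> (\<exists>F W. chain_data F W \<and> S = chain_sphere F W)"
proof
  assume "minimal_NH_sphere S"
  then show "\<exists>F W. chain_data F W \<and> S = chain_sphere F W"
    unfolding minimal_NH_sphere_def using minimal_NH_sphere_chain by blast
next
  assume "\<exists>F W. chain_data F W \<and> S = chain_sphere F W"
  then obtain F W where data: "chain_data F W" and S: "S = chain_sphere F W" by blast
  have "int (num_principal S) = (int (card F) - 1) + 2"
    using num_principal_chain_sphere[OF data] S by simp
  then show "minimal_NH_sphere S"
    unfolding minimal_NH_sphere_def using NH_chain_sphere_ball(1)[OF data] S by blast
qed

section \<open>Duality\<close>

text \<open>The ambient set \<open>V\<close> is carried along because the dual depends on it. The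
  start has one ambient vertex since over the empty set the dual of \<open>{{}}\<close> is
  void.\<close>

inductive iterated_dual :: "'a set \<Rightarrow> 'a set set \<Rightarrow> bool" where
  point: "iterated_dual {w} {{}}"
| ghost: "iterated_dual V K \<Longrightarrow> x \<notin> V \<Longrightarrow> iterated_dual (insert x V) K"
| cone: "iterated_dual V K \<Longrightarrow> x \<notin> V \<Longrightarrow> iterated_dual (insert x V) (Pow V \<union> insert x ` K)"

lemma iterated_dual_subset: "iterated_dual V K \<Longrightarrow> \<sigma> \<in> K \<Longrightarrow> \<sigma> \<subseteq> V"
  by (induction arbitrary: \<sigma> rule: iterated_dual.induct) blast+

text \<open>If \<open>x \<notin> \<sigma>\<close>, the complement of \<open>\<sigma>\<close>
  contains \<open>x\<close> and so is not in \<open>K\<close>; this gives all of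
  \<open>Pow V\<close>. If \<open>x \<in> \<sigma>\<close>, the complement is that of
  \<open>\<sigma> - {x}\<close> in \<open>V\<close>.\<close>

lemma alexander_dual_ghost:
  assumes "x \<notin> V" "K \<subseteq> Pow V"
  shows "alexander_dual (insert x V) K = Pow V \<union> insert x ` alexander_dual V K"
proof (intro equalityI subsetI)
  fix \<sigma> assume "\<sigma> \<in> alexander_dual (insert x V) K"
  then have \<sigma>: "\<sigma> \<subseteq> insert x V" "insert x V - \<sigma> \<notin> K" by (auto simp: alexander_dual_def)
  show "\<sigma> \<in> Pow V \<union> insert x ` alexander_dual V K"
  proof (cases "x \<in> \<sigma>")
    case True
    then have "V - (\<sigma> - {x}) = insert x V - \<sigma>" "\<sigma> = insert x (\<sigma> - {x})" "\<sigma> - {x} \<subseteq> V"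
      using \<sigma> assms(1) by auto
    moreover from this have "\<sigma> - {x} \<in> alexander_dual V K"
      using \<sigma>(2) by (simp add: alexander_dual_def)
    ultimately show ?thesis by blast
  next
    case False
    then show ?thesis using \<sigma>(1) by blast
  qed
next
  fix \<sigma> assume "\<sigma> \<in> Pow V \<union> insert x ` alexander_dual V K"
  then consider "\<sigma> \<subseteq> V" | \<rho> where "\<sigma> = insert x \<rho>" "\<rho> \<subseteq> V" "V - \<rho> \<notin> K"
    by (auto simp: alexander_dual_def)
  then show "\<sigma> \<in> alexander_dual (insert x V) K"
  proof cases
    case 1
    then have "x \<in> insert x V - \<sigma>" using assms(1) by blast
    then have "insert x V - \<sigma> \<notin> K" using assms by blast
    then show ?thesis using 1 by (auto simp: alexander_dual_def)
  next
    case 2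
    then have "insert x V - \<sigma> = V - \<rho>" using assms(1) by blast
    then show ?thesis using 2 by (auto simp: alexander_dual_def)
  qed
qed

text \<open>If \<open>x \<in> \<sigma>\<close>, the complement lies in \<open>V\<close> and is a
  simplex, so \<open>\<sigma>\<close> is not in the dual. If \<open>x \<notin> \<sigma>\<close>, the
  complement is \<open>V - \<sigma>\<close> with \<open>x\<close> added, and \<open>x\<close> can be
  cancelled.\<close>

lemma alexander_dual_cone:
  assumes "x \<notin> V" "K \<subseteq> Pow V"
  shows "alexander_dual (insert x V) (Pow V \<union> insert x ` K) = alexander_dual V K"
proof (intro equalityI subsetI)
  fix \<sigma> assume "\<sigma> \<in> alexander_dual (insert x V) (Pow V \<union> insert x ` K)"
  then have \<sigma>: "\<sigma> \<subseteq> insert x V" "\<not> insert x V - \<sigma> \<subseteq> V" "insert x V - \<sigma> \<notin> insert x ` K"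
    by (auto simp: alexander_dual_def)
  then have "x \<notin> \<sigma>" by blast
  then have "insert x V - \<sigma> = insert x (V - \<sigma>)" "\<sigma> \<subseteq> V" using \<sigma>(1) by auto
  then show "\<sigma> \<in> alexander_dual V K" using \<sigma>(3) by (auto simp: alexander_dual_def)
next
  fix \<sigma> assume "\<sigma> \<in> alexander_dual V K"
  then have \<sigma>: "\<sigma> \<subseteq> V" "V - \<sigma> \<notin> K" by (auto simp: alexander_dual_def)
  then have eq: "insert x V - \<sigma> = insert x (V - \<sigma>)" using assms(1) by auto
  have "insert x (V - \<sigma>) \<noteq> insert x \<rho>" if "\<rho> \<in> K" for \<rho>
  proof
    assume "insert x (V - \<sigma>) = insert x \<rho>"
    moreover have "x \<notin> \<rho>" "x \<notin> V - \<sigma>" using that assms by blast+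
    ultimately have "V - \<sigma> = \<rho>" by (simp add: insert_ident)
    then show False using \<sigma> that by blast
  qed
  then show "\<sigma> \<in> alexander_dual (insert x V) (Pow V \<union> insert x ` K)"
    using \<sigma>(1) assms(1) by (auto simp: alexander_dual_def eq)
qed

lemma alexander_dual_involutive:
  assumes "K \<subseteq> Pow V"
  shows "alexander_dual V (alexander_dual V K) = K"
proof -
  have "V - (V - \<sigma>) = \<sigma>" if "\<sigma> \<subseteq> V" for \<sigma> using that by blast
  then show ?thesis using assms by (auto simp: alexander_dual_def)
qed

text \<open>The starting complex is self-dual, and each construction step is exchanged with the
  other one.\<close>

lemma iterated_dual_alexander_dual:
  "iterated_dual V K \<Longrightarrow> iterated_dual V (alexander_dual V K)"
proof (induction rule: iterated_dual.induct)
  case (point w)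
  have "alexander_dual {w} {{}} = {{}}" by (auto simp: alexander_dual_def)
  then show ?case using iterated_dual.point by simp
next
  case (ghost V K x)
  then have "K \<subseteq> Pow V" using iterated_dual_subset by blast
  then show ?case using ghost iterated_dual.cone by (simp add: alexander_dual_ghost)
next
  case (cone V K x)
  then have "K \<subseteq> Pow V" using iterated_dual_subset by blast
  then show ?case using cone iterated_dual.ghost by (simp add: alexander_dual_cone)
qed

section \<open>Chain spheres as iterated constructions\<close>

text \<open>The choice \<open>W x = V - F\<close> makes the generating simplex indexed by
  \<open>x\<close> equal to \<open>V\<close>; every other principal simplex just acquires
  \<open>x\<close>.\<close>

lemma chain_sphere_insert:
  assumes "x \<notin> F" "F \<subseteq> V" "\<And>u. u \<in> F \<Longrightarrow> x \<notin> W u \<and> W u \<subseteq> V" "W x = V - F"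
  shows "chain_sphere (insert x F) W = Pow V \<union> insert x ` chain_sphere F W"
proof (intro equalityI subsetI)
  fix \<sigma> assume "\<sigma> \<in> chain_sphere (insert x F) W"
  then consider "\<sigma> \<subseteq> insert x F" | "\<sigma> \<subseteq> insert x F - {x} \<union> W x"
    | u where "u \<in> F" "\<sigma> \<subseteq> insert x F - {u} \<union> W u"
    unfolding chain_sphere_def chain_ball_def by blast
  then have "\<sigma> \<subseteq> V \<or> \<sigma> - {x} \<in> chain_sphere F W \<and> x \<in> \<sigma>"
  proof cases
    case 3
    then have "\<sigma> - {x} \<subseteq> F - {u} \<union> W u" by blast
    then have "\<sigma> - {x} \<in> chain_sphere F W" using 3(1) unfolding chain_sphere_def chain_ball_def by blast
    moreover have "\<sigma> \<subseteq> V" if "x \<notin> \<sigma>" using 3 that assms(2,3) by blast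
    ultimately show ?thesis by blast
  qed (use assms in \<open>auto simp: chain_sphere_def\<close>)
  then show "\<sigma> \<in> Pow V \<union> insert x ` chain_sphere F W" by (auto intro: image_eqI[of _ _ "\<sigma> - {x}"])
next
  fix \<sigma> assume "\<sigma> \<in> Pow V \<union> insert x ` chain_sphere F W"
  then consider "\<sigma> \<subseteq> V" | \<rho> where "\<sigma> = insert x \<rho>" "\<rho> \<subseteq> F"
    | \<rho> u where "\<sigma> = insert x \<rho>" "u \<in> F" "\<rho> \<subseteq> F - {u} \<union> W u"
    unfolding chain_sphere_def chain_ball_def by blast
  then show "\<sigma> \<in> chain_sphere (insert x F) W"
  proof cases
    case 1
    then have "\<sigma> \<subseteq> insert x F - {x} \<union> W x" using assms by blast
    then show ?thesis unfolding chain_sphere_def chain_ball_def by blast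
  next
    case 2
    then show ?thesis unfolding chain_sphere_def by blast
  next
    case 3
    then have "\<sigma> \<subseteq> insert x F - {u} \<union> W u" using assms(1) by blast
    then show ?thesis using 3(2) unfolding chain_sphere_def chain_ball_def by blast
  qed
qed

text \<open>Induction on the ambient set. An ambient vertex outside the complex is removed as a
  ghost; if there is none, the element \<open>x\<close> of \<open>F\<close> with the largest apex
  set is removed as a cone vertex.\<close>

lemma chain_sphere_iterated_dual:
  assumes "chain_data F W" "finite V" "F \<union> (\<Union>v\<in>F. W v) \<subseteq> V" "F \<noteq> V"
  shows "iterated_dual V (chain_sphere F W)"
  using assms
proof (induction "card V" arbitrary: V F rule: less_induct)
  case less
  note data = less.prems(1)
  have W: "W v \<noteq> {}" "W v \<inter> F = {}" if "v \<in> F" for v using data that by (auto simp: chain_data_def)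
  have smaller: "card (V - {x}) < card V" if "x \<in> V" for x
    using that less.prems(2) by (rule card_Diff1_less[rotated])
  show ?case
  proof (cases "V = F \<union> (\<Union>v\<in>F. W v)")
    case False
    then obtain x where x: "x \<in> V" "x \<notin> F \<union> (\<Union>v\<in>F. W v)" using less.prems(3) by blast
    have V: "V = insert x (V - {x})" using x by blast
    show ?thesis
    proof (cases "F = V - {x}")
      \<comment> \<open>Removing \<open>x\<close> would leave \<open>F\<close> as the whole ambient
        set. A nonempty \<open>F\<close> has apex vertices outside it, so \<open>F\<close> is empty
        and this is the starting complex.\<close>
      case True
      have "F = {}"
      proof (rule ccontr)
        assume "F \<noteq> {}"
        then obtain v where "v \<in> F" by blast
        then obtain w where "w \<in> W v" using W by blast
        then have "w \<in> V" "w \<noteq> x" "w \<notin> F" using W(2) \<open>v \<in> F\<close> less.prems(3) x(2) by auto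
        then show False using True by blast
      qed
      then have "V = {x}" "chain_sphere F W = {{}}"
        using True V by (auto simp: chain_sphere_def chain_ball_def)
      then show ?thesis using iterated_dual.point by simp
    next
      case False
      have "iterated_dual (V - {x}) (chain_sphere F W)"
        by (rule less.hyps[OF smaller[OF x(1)] data _ _ False]) (use less.prems x in auto)
      then show ?thesis using iterated_dual.ghost[of "V - {x}" _ x] V by simp
    qed
  next
    case V: True
    then have "F \<noteq> {}" using less.prems(4) by auto
    then obtain x where x: "x \<in> F" "\<forall>v\<in>F. W v \<subseteq> W x"
      using finite_chain_has_min(2)[of F W] data by (auto simp: chain_data_def)
    have ne: "F - {x} \<noteq> V - {x}" using x V less.prems(4) by blast
    have sub: "F - {x} \<union> (\<Union>v\<in>F - {x}. W v) \<subseteq> V - {x}" using V W(2) x(1) by blast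
    have "iterated_dual (V - {x}) (chain_sphere (F - {x}) W)"
      by (rule less.hyps[OF smaller chain_data_subset[OF data] _ sub ne]) (use x V less.prems(2) in auto)
    then have "iterated_dual (insert x (V - {x})) (Pow (V - {x}) \<union> insert x ` chain_sphere (F - {x}) W)"
      by (rule iterated_dual.cone) simp
    moreover have "chain_sphere (insert x (F - {x})) W = Pow (V - {x}) \<union> insert x ` chain_sphere (F - {x}) W"
    proof (rule chain_sphere_insert)
      \<comment> \<open>The largest apex set is the union of all of them, which is everything in
        \<open>V\<close> outside \<open>F\<close>.\<close>
      have "W x = (\<Union>v\<in>F. W v)" using x by blast
      then show "W x = V - {x} - (F - {x})" using V W(2) x(1) by blast
      show "\<And>u. u \<in> F - {x} \<Longrightarrow> x \<notin> W u \<and> W u \<subseteq> V - {x}" using sub by blast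
    qed (use sub in auto)
    moreover have "insert x (F - {x}) = F" "insert x (V - {x}) = V" using x V by blast+
    ultimately show ?thesis by simp
  qed
qed

lemma iterated_dual_chain_sphere:
  assumes "iterated_dual V K"
  shows "finite V \<and> (\<exists>F W. chain_data F W \<and> K = chain_sphere F W \<and>
    F \<union> (\<Union>v\<in>F. W v) \<subseteq> V \<and> F \<noteq> V)"
  using assms
proof (induction rule: iterated_dual.induct)
  case (point w)
  have "chain_data {} (\<lambda>_. {}) \<and> {{}} = chain_sphere {} (\<lambda>_. {})"
    by (simp add: chain_data_def chain_sphere_def chain_ball_def)
  then show ?case by (intro conjI exI[of _ "{}"] exI[of _ "\<lambda>_. {}"]) auto
next
  case (ghost V K x)
  then obtain F W where "chain_data F W" "K = chain_sphere F W" "F \<union> (\<Union>v\<in>F. W v) \<subseteq> V" "F \<noteq> V"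
    by blast
  moreover from this have "F \<union> (\<Union>v\<in>F. W v) \<subseteq> insert x V" "F \<noteq> insert x V" using ghost by blast+
  ultimately show ?case using ghost by blast
next
  case (cone V K x)
  then obtain F W where data: "chain_data F W" and K: "K = chain_sphere F W"
    and V: "F \<union> (\<Union>v\<in>F. W v) \<subseteq> V" "F \<noteq> V" by blast
  \<comment> \<open>\<open>V - F\<close> is nonempty because \<open>F \<noteq> V\<close>, and it
    contains every \<open>W v\<close> with \<open>v \<in> F\<close>, so it extends the chain at the
    top.\<close>
  define U where "U = W(x := V - F)"
  have xF: "x \<notin> F" using V cone.hyps by blast
  have U: "U v = W v" if "v \<in> F" for v using that xF by (auto simp: U_def)
  have "chain_data (insert x F) U"
    unfolding chain_data_def
  proof (intro conjI ballI)
    show "finite (insert x F)" using data by (simp add: chain_data_def)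
    fix u assume u: "u \<in> insert x F"
    show "finite (U u)" "U u \<noteq> {}" "U u \<inter> insert x F = {}"
      using u data V cone by (auto simp: U_def chain_data_def)
    fix v assume "v \<in> insert x F"
    moreover have "W y \<subseteq> V - F" if "y \<in> F" for y using that V data by (auto simp: chain_data_def)
    moreover have "W u \<subseteq> W v \<or> W v \<subseteq> W u" if "u \<in> F" "v \<in> F"
      using that data by (simp add: chain_data_def)
    ultimately show "U u \<subseteq> U v \<or> U v \<subseteq> U u" using u by (cases "u = x"; cases "v = x") (simp_all add: U_def)
  qed
  moreover have "chain_sphere F U = chain_sphere F W"
    using U by (simp add: chain_sphere_def chain_ball_def)
  moreover have "chain_sphere (insert x F) U = Pow V \<union> insert x ` chain_sphere F U"
  proof (rule chain_sphere_insert[OF xF])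
    show "\<And>u. u \<in> F \<Longrightarrow> x \<notin> U u \<and> U u \<subseteq> V" using U V cone.hyps by auto
  qed (use V in \<open>auto simp: U_def\<close>)
  moreover have "insert x F \<union> (\<Union>v\<in>insert x F. U v) \<subseteq> insert x V"
    using V U by (auto simp: U_def)
  moreover have "insert x F \<noteq> insert x V" using V xF cone.hyps by (simp add: insert_ident)
  ultimately show ?case using K cone.IH by (metis finite_insert)
qed

text \<open>For nonempty \<open>V\<close> the base \<open>F\<close> cannot exhaust \<open>V\<close>,
  since the apex set of any of its elements lies in \<open>V\<close> outside \<open>F\<close>; this
  gives the condition \<open>F \<noteq> V\<close> of the induction.\<close>

lemma minimal_NH_sphere_iff_iterated_dual:
  assumes "finite V" "V \<noteq> {}" "vertices K \<subseteq> V"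
  shows "minimal_NH_sphere K \<longleftrightarrow> iterated_dual V K"
proof
  assume "minimal_NH_sphere K"
  then obtain F W where data: "chain_data F W" and K: "K = chain_sphere F W"
    unfolding minimal_NH_sphere_iff_chain_sphere by blast
  have V: "F \<union> (\<Union>v\<in>F. W v) \<subseteq> V" using assms(3) by (simp add: K vertices_chain_sphere)
  moreover have "F \<noteq> V"
  proof
    assume "F = V"
    then obtain v where v: "v \<in> F" using assms(2) by blast
    then have "W v \<noteq> {}" "W v \<inter> F = {}" using data by (auto simp: chain_data_def)
    then show False using V v \<open>F = V\<close> by blast
  qed
  ultimately show "iterated_dual V K" using chain_sphere_iterated_dual[OF data assms(1)] K by blast
next
  assume "iterated_dual V K"
  from iterated_dual_chain_sphere[OF this] show "minimal_NH_sphere K"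
    unfolding minimal_NH_sphere_iff_chain_sphere by blast
qed

theorem theorem3p6:
  fixes K :: "'a set set" and \<tau> :: "'a set"
  assumes "abstract_complex K"
    and "finite \<tau>" and "\<tau> \<inter> vertices K = {}"
    and "\<not> (K = {{}} \<and> \<tau> = {})"
  shows "minimal_NH_sphere K \<longleftrightarrow> minimal_NH_sphere (relative_dual K \<tau>)"
proof -
  define V where "V = vertices K \<union> \<tau>"
  have finV: "finite V" using assms(2) finite_vertices[OF assms(1)] by (simp add: V_def)
  have KV: "K \<subseteq> Pow V" by (auto simp: V_def vertices_def)
  \<comment> \<open>An empty ambient set occurs only in the excluded case, where the dual is
    void.\<close>
  have neV: "V \<noteq> {}"
  proof
    assume "V = {}"
    then have "K = {{}}" "\<tau> = {}" using KV assms(1) by (auto simp: V_def abstract_complex_def)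
    then show False using assms(4) by blast
  qed
  have "minimal_NH_sphere K \<longleftrightarrow> iterated_dual V K"
    by (rule minimal_NH_sphere_iff_iterated_dual[OF finV neV]) (simp add: V_def)
  \<comment> \<open>Invariance under duality is applied to \<open>K\<close> in one direction and to
    its dual in the other, with double duality returning \<open>K\<close>.\<close>
  also have "\<dots> \<longleftrightarrow> iterated_dual V (alexander_dual V K)"
    using iterated_dual_alexander_dual[of V] alexander_dual_involutive[OF KV] by metis
  also have "\<dots> \<longleftrightarrow> minimal_NH_sphere (alexander_dual V K)"
    by (rule minimal_NH_sphere_iff_iterated_dual[OF finV neV, symmetric])
      (auto simp: vertices_def alexander_dual_def)
  finally show ?thesis by (simp add: relative_dual_def V_def)
qed

end
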